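(* a) Let $0<p<1$. There exists a constant $c_p>0$, depending only on $p$, such that for every $f\in H_p(G_m)$ and all integers $k\ge0$ and $n$ with $M_k<n\le M_{k+1}$, $$\|S_nf-f\|_{H_p}\le\frac{c_p\,M_{|n|}^{1/p-1}}{M_{\langle n\rangle}^{1/p-1}}\;\omega\!\left(\frac1{M_k},f\right)_{H_p(G_m)} .$$ Moreover, if $f\in H_p(G_m)$ and $\{n_k:k\in\mathbb{N}\}$ is an increasing sequence of positive integers such that $$\omega\!\left(\frac1{M_{|n_k|}},f\right)_{H_p(G_m)}=o\!\left(\frac{M_{\langle n_k\rangle}^{1/p-1}}{M_{|n_k|}^{1/p-1}}\right)\quad\text{as }k\to\infty,$$ then $\|S_{n_k}f-f\|_{H_p}\to0$ as $k\to\infty$. b) Let $0<p<1$ and let $\{n_k:k\in\mathbb{N}\}$ be an increasing sequence of positive integers such that $\sup_{k\in\mathbb{N}}\rho(n_k)=\infty$. Then there exist a martingale $f\in H_p(G_m)$ and a subsequence $\{\alpha_k:k\in\mathbb{N}\}\subset\{n_k:k\in\mathbb{N}\}$ for which $$\omega\!\left(\frac1{M_{|\alpha_k|}},f\right)_{H_p(G_m)}=O\!\left(\frac{M_{\langle\alpha_k\rangle}^{1/p-1}}{M_{|\alpha_k|}^{1/p-1}}\right)\quad\text{as }k\to\infty$$ and, for some constant $c>0$, $$\limsup_{k\to\infty}\|S_{\alpha_k}f-f\|_{L_{p,\infty}}>c>0 .$$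
   Context: $\mathbb{N}=\{0,1,2,\dots\}$. Fix a bounded sequence $m=(m_0,m_1,\dots)$ of integers $m_k\ge 2$; constants "depending only on $p$" are understood for this fixed $m$. Let $Z_{m_k}=\{0,1,\dots,m_k-1\}$ be the additive group of integers modulo $m_k$, and $G_m=\prod_{k\ge0}Z_{m_k}$ with the product topology and normalized Haar measure $\mu$ (the product of the uniform probability measures on the $Z_{m_k}$). Elements are $x=(x_0,x_1,\dots)$. Put $I_0(x)=G_m$ and $I_n(x)=\{y\in G_m: y_0=x_0,\dots,y_{n-1}=x_{n-1}\}$. Put $M_0=1$, $M_{k+1}=m_kM_k$. Every $n\in\mathbb{N}$ is uniquely $n=\sum_{j\ge0}n_jM_j$ with $n_j\in Z_{m_j}$, only finitely many nonzero. For $n\ge1$: $\langle n\rangle=\min\{j:n_j\ne0\}$, $|n|=\max\{j:n_j\neq0\}$, $\rho(n)=|n|-\langle n\rangle$. Vilenkin system: $r_k(x)=\exp(2\pi i x_k/m_k)$, $\psi_n(x)=\prod_{k\ge0}r_k^{n_k}(x)$. Let $\digamma_n$ be the $\sigma$-algebra generated by $\{I_n(x):x\in G_m\}$. Martingales $f=(f_n)_{n\in\mathbb{N}}$ are complex-valued and with respect to $(\digamma_n)$. Fourier coefficients: $\widehat f(i)=\lim_{k\to\infty}\int_{G_m}f_k\overline{\psi_i}\,d\mu$. Partial sums: $S_nf=\sum_{k=0}^{n-1}\widehat f(k)\psi_k$. Maximal function: $f^*=\sup_n|f_n|$. $H_p(G_m)$ is the set of martingales with $\|f\|_{H_p}:=\|f^*\|_p=(\int_{G_m}|f^*|^p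 d\mu)^{1/p}<\infty$. An integrable function $g$ (e.g. $S_nf$) is identified with the martingale $(S_{M_n}g)_{n}$, so that $S_nf-f$ is a martingale. Modulus of continuity: $\omega(1/M_n,f)_{H_p(G_m)}:=\|f-S_{M_n}f\|_{H_p}$. For measurable $g$, $\|g\|_{L_{p,\infty}}=\sup_{\lambda>0}\lambda\,\mu(|g|>\lambda)^{1/p}$; inside an $L_{p,\infty}$ quasi-norm, a martingale $f\in H_p(G_m)$ stands for its almost everywhere limit $\lim_n f_n$. *)

theory Defs
  imports "HOL-Probability.Probability"
begin

section \<open>Generalized number systems\<close>

fun gen_pow :: "(nat \<Rightarrow> nat) \<Rightarrow> nat \<Rightarrow> nat" where
  "gen_pow m 0 = 1"
| "gen_pow m (Suc k) = m k * gen_pow m k"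

definition digit :: "(nat \<Rightarrow> nat) \<Rightarrow> nat \<Rightarrow> nat \<Rightarrow> nat" where
  "digit m n j = (n div gen_pow m j) mod m j"

definition low_idx :: "(nat \<Rightarrow> nat) \<Rightarrow> nat \<Rightarrow> nat" where
  "low_idx m n = Min {j. digit m n j \<noteq> 0}"

definition high_idx :: "(nat \<Rightarrow> nat) \<Rightarrow> nat \<Rightarrow> nat" where
  "high_idx m n = Max {j. digit m n j \<noteq> 0}"

definition rho :: "(nat \<Rightarrow> nat) \<Rightarrow> nat \<Rightarrow> nat" where
  "rho m n = high_idx m n - low_idx m n"

text \<open>The digits are those of the expansion of \<open>n\<close> in the system \<open>(gen_pow m k)\<close>, and only finitely
  many of them are nonzero, so that \<open>Min\<close> and \<open>Max\<close> above are taken over finite sets.\<close>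

lemma gen_pow_ge:
  assumes "\<And>k. m k \<ge> 2"
  shows "gen_pow m k \<ge> 2 ^ k"
  by (induction k) (auto intro!: mult_mono simp: assms)

lemma digit_expansion_mod: "n mod gen_pow m k = (\<Sum>j<k. digit m n j * gen_pow m j)"
proof (induction k)
  case (Suc k)
  have "n mod (gen_pow m k * m k) = gen_pow m k * (n div gen_pow m k mod m k) + n mod gen_pow m k"
    by (rule mod_mult2_eq)
  with Suc show ?case by (simp add: digit_def mult.commute)
qed simp

lemma digit_eq_0:
  assumes "\<And>k. m k \<ge> 2" "n \<le> j"
  shows "digit m n j = 0"
proof -
  have "n < 2 ^ n" by simp
  also have "\<dots> \<le> (2::nat) ^ j" using assms(2) by simp
  also have "\<dots> \<le> gen_pow m j" by (rule gen_pow_ge[OF assms(1)])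
  finally show ?thesis by (simp add: digit_def)
qed

lemma finite_digits:
  assumes "\<And>k. m k \<ge> 2"
  shows "finite {j. digit m n j \<noteq> 0}"
proof (rule finite_subset)
  show "{j. digit m n j \<noteq> 0} \<subseteq> {..<n}"
    using digit_eq_0[of m n, OF assms] by (force simp: not_less[symmetric])
qed simp

lemma digit_expansion:
  assumes "\<And>k. m k \<ge> 2"
  shows "n = (\<Sum>j | digit m n j \<noteq> 0. digit m n j * gen_pow m j)"
proof -
  have "n < 2 ^ n" by simp
  also have "\<dots> \<le> gen_pow m n" by (rule gen_pow_ge[OF assms])
  finally have "n = (\<Sum>j<n. digit m n j * gen_pow m j)"
    using digit_expansion_mod[of n m n] by simp
  also have "\<dots> = (\<Sum>j | digit m n j \<noteq> 0. digit m n j * gen_pow m j)"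
  proof (rule sum.mono_neutral_right)
    show "{j. digit m n j \<noteq> 0} \<subseteq> {..<n}"
      using digit_eq_0[of m n, OF assms] by (force simp: not_less[symmetric])
  qed auto
  finally show ?thesis .
qed

section \<open>Bounded Vilenkin groups and Vilenkin systems\<close>

text \<open>The residues modulo \<open>m k\<close> are represented by \<open>{..<m k}\<close>; the underlying set of the Vilenkin
  group is \<open>space (vilenkin m)\<close>, and the product of the uniform measures is its Haar measure.\<close>

definition vilenkin :: "(nat \<Rightarrow> nat) \<Rightarrow> (nat \<Rightarrow> nat) measure" where
  "vilenkin m = (\<Pi>\<^sub>M k\<in>UNIV. uniform_count_measure {..<m k})"

definition cyl :: "(nat \<Rightarrow> nat) \<Rightarrow> nat \<Rightarrow> (nat \<Rightarrow> nat) \<Rightarrow> (nat \<Rightarrow> nat) set" where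
  "cyl m n x = {y \<in> space (vilenkin m). \<forall>j<n. y j = x j}"

definition vfilt :: "(nat \<Rightarrow> nat) \<Rightarrow> nat \<Rightarrow> (nat \<Rightarrow> nat) measure" where
  "vfilt m n = sigma (space (vilenkin m)) {cyl m n x | x. x \<in> space (vilenkin m)}"

definition rademacher :: "(nat \<Rightarrow> nat) \<Rightarrow> nat \<Rightarrow> (nat \<Rightarrow> nat) \<Rightarrow> complex" where
  "rademacher m k x = exp (2 * pi * \<i> * of_nat (x k) / of_nat (m k))"

definition psi :: "(nat \<Rightarrow> nat) \<Rightarrow> nat \<Rightarrow> (nat \<Rightarrow> nat) \<Rightarrow> complex" where
  "psi m n x = (\<Prod>k | digit m n k \<noteq> 0. rademacher m k x ^ digit m n k)"

section \<open>Martingales and partial sums\<close>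

definition complex_cond_exp ::
  "'a measure \<Rightarrow> 'a measure \<Rightarrow> ('a \<Rightarrow> complex) \<Rightarrow> 'a \<Rightarrow> complex" where
  "complex_cond_exp M F f x =
     Complex (real_cond_exp M F (\<lambda>y. Re (f y)) x) (real_cond_exp M F (\<lambda>y. Im (f y)) x)"

type_synonym process = "nat \<Rightarrow> (nat \<Rightarrow> nat) \<Rightarrow> complex"

definition is_martingale :: "(nat \<Rightarrow> nat) \<Rightarrow> process \<Rightarrow> bool" where
  "is_martingale m f \<longleftrightarrow>
     (\<forall>n. f n \<in> borel_measurable (vfilt m n)) \<and>
     (\<forall>n. integrable (vilenkin m) (f n)) \<and>
     (\<forall>n k. n \<le> k \<longrightarrow> (AE x in vilenkin m. complex_cond_exp (vilenkin m) (vfilt m n) (f k) x = f n x))"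

definition mart_coeff :: "(nat \<Rightarrow> nat) \<Rightarrow> process \<Rightarrow> nat \<Rightarrow> complex" where
  "mart_coeff m f i = lim (\<lambda>k. LINT x|vilenkin m. f k x * cnj (psi m i x))"

definition mart_sum :: "(nat \<Rightarrow> nat) \<Rightarrow> nat \<Rightarrow> process \<Rightarrow> (nat \<Rightarrow> nat) \<Rightarrow> complex" where
  "mart_sum m n f x = (\<Sum>i<n. mart_coeff m f i * psi m i x)"

definition fun_coeff :: "(nat \<Rightarrow> nat) \<Rightarrow> ((nat \<Rightarrow> nat) \<Rightarrow> complex) \<Rightarrow> nat \<Rightarrow> complex" where
  "fun_coeff m g i = (LINT x|vilenkin m. g x * cnj (psi m i x))"

definition fun_sum ::
  "(nat \<Rightarrow> nat) \<Rightarrow> nat \<Rightarrow> ((nat \<Rightarrow> nat) \<Rightarrow> complex) \<Rightarrow> (nat \<Rightarrow> nat) \<Rightarrow> complex" where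
  "fun_sum m n g x = (\<Sum>i<n. fun_coeff m g i * psi m i x)"

text \<open>The martingale with which an integrable function is identified.\<close>

definition mart_of :: "(nat \<Rightarrow> nat) \<Rightarrow> ((nat \<Rightarrow> nat) \<Rightarrow> complex) \<Rightarrow> process" where
  "mart_of m g n = fun_sum m (gen_pow m n) g"

text \<open>The martingale \<open>S\<^sub>n f - f\<close>.\<close>

definition sum_diff :: "(nat \<Rightarrow> nat) \<Rightarrow> nat \<Rightarrow> process \<Rightarrow> process" where
  "sum_diff m n f j x = mart_of m (mart_sum m n f) j x - f j x"

section \<open>Hardy spaces and weak Lebesgue spaces\<close>

text \<open>Used only for exponents \<open>a > 0\<close>.\<close>

definition ennreal_powr :: "ennreal \<Rightarrow> real \<Rightarrow> ennreal" where
  "ennreal_powr x a = (if x = \<infinity> then \<infinity> else ennreal (enn2real x powr a))"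

definition maximal :: "process \<Rightarrow> (nat \<Rightarrow> nat) \<Rightarrow> ennreal" where
  "maximal f x = (SUP n. ennreal (norm (f n x)))"

definition hardy_norm :: "(nat \<Rightarrow> nat) \<Rightarrow> real \<Rightarrow> process \<Rightarrow> ennreal" where
  "hardy_norm m p f =
     ennreal_powr (\<integral>\<^sup>+ x. ennreal_powr (maximal f x) p \<partial>vilenkin m) (1 / p)"

definition hardy :: "(nat \<Rightarrow> nat) \<Rightarrow> real \<Rightarrow> process set" where
  "hardy m p = {f. is_martingale m f \<and> hardy_norm m p f < \<infinity>}"

text \<open>\<open>modulus m p n f\<close> is the modulus of continuity of \<open>f\<close> in the Hardy space at \<open>1 / gen_pow m n\<close>.\<close>

definition modulus :: "(nat \<Rightarrow> nat) \<Rightarrow> real \<Rightarrow> nat \<Rightarrow> process \<Rightarrow> ennreal" where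
  "modulus m p n f =
     hardy_norm m p (\<lambda>j x. f j x - mart_of m (mart_sum m (gen_pow m n) f) j x)"

definition weak_norm :: "(nat \<Rightarrow> nat) \<Rightarrow> real \<Rightarrow> ((nat \<Rightarrow> nat) \<Rightarrow> complex) \<Rightarrow> ennreal" where
  "weak_norm m p g =
     (SUP l\<in>{0<..}. ennreal (l * measure (vilenkin m) {x \<in> space (vilenkin m). norm (g x) > l} powr (1 / p)))"

text \<open>The pointwise limit of a martingale. On the null set where the sequence diverges it is a fixed
  arbitrary value, so that the function is measurable.\<close>

definition mart_lim :: "process \<Rightarrow> (nat \<Rightarrow> nat) \<Rightarrow> complex" where
  "mart_lim f x = lim (\<lambda>n. f n x)"

section \<open>Orders of magnitude\<close>

text \<open>The Landau relations, unfolded for an \<open>ennreal\<close>-valued left-hand side (so that finiteness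
  need not be presupposed) and a nonnegative right-hand side.\<close>

definition ennreal_smallo :: "(nat \<Rightarrow> ennreal) \<Rightarrow> (nat \<Rightarrow> real) \<Rightarrow> bool" where
  "ennreal_smallo u a \<longleftrightarrow> (\<forall>e>0. \<forall>\<^sub>F k in sequentially. u k \<le> ennreal (e * a k))"

definition ennreal_bigo :: "(nat \<Rightarrow> ennreal) \<Rightarrow> (nat \<Rightarrow> real) \<Rightarrow> bool" where
  "ennreal_bigo u a \<longleftrightarrow> (\<exists>C>0. \<forall>\<^sub>F k in sequentially. u k \<le> ennreal (C * a k))"

end

theory Submission
  imports Defs
begin

text \<open>
  Throughout, \<open>K\<^sub>n (x, t) = \<Sum>\<^bsub>i<n\<^esub> \<psi>\<^sub>i (x) cnj (\<psi>\<^sub>i (t))\<close> is the Dirichlet kernel, so that \<open>S\<^sub>n g (x)\<close>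
  is the integral of \<open>g\<close> against \<open>K\<^sub>n (x, \<cdot>)\<close>. The kernel \<open>K\<^sub>n\<close> with \<open>n = M\<^sub>j\<close> is \<open>M\<^sub>j\<close> times the
  indicator of the pairs of points lying in the same cell of level \<open>j\<close>; hence \<open>S\<^sub>n f = f\<^sub>j\<close> for this
  \<open>n\<close>. Splitting off one digit of \<open>n\<close> at a time shows that \<open>|K\<^sub>n (x, t)|\<close> is at most the sum of
  \<open>M\<^bsub>j+1\<^esub>\<close> over those places \<open>j\<close> of nonzero digits of \<open>n\<close> for which \<open>x\<close> and \<open>t\<close> lie in the same cell of
  level \<open>j\<close> (\<open>kernel_bound\<close>).

  The direct estimate. Let \<open>M\<^sub>k \<le> n \<le> M\<^bsub>k+1\<^esub>\<close> and let \<open>W\<close> be the maximal function of \<open>f - f\<^sub>k\<close>, where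
  \<open>f\<^sub>k\<close> is the partial sum of order \<open>M\<^sub>k\<close>. The maximal function of \<open>S\<^sub>n f - f\<close> is at most \<open>|S\<^sub>n h| + W\<close> with
  the single increment \<open>h = f\<^bsub>k+1\<^esub> - f\<^sub>k\<close>, and \<open>|h| \<le> W\<close> (\<open>maximal_sum_diff_le\<close>). Since \<open>h\<close> is constant on
  the cells of level \<open>J = |n| + 1\<close>, the \<open>p\<close>-th power of the integral of \<open>|h|\<close> over a cell of level at
  most \<open>J\<close> is bounded by \<open>M\<^sub>J\<^bsup>1-p\<^esup>\<close> times the integral of \<open>|h|\<^sup>p\<close> over that cell
  (\<open>integral_cell_powr_le\<close>). With the bound of the kernel and Fubini's theorem, the integral of
  \<open>|S\<^sub>n h|\<^sup>p\<close> is bounded by that of \<open>|h|\<^sup>p\<close> times \<open>M\<^sub>J\<^bsup>1-p\<^esup>\<close> times a sum of numbers comparable to \<open>M\<^sub>j\<^bsup>p-1\<^esup>\<close>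
  with \<open>j\<close> between \<open>\<langle>n\<rangle>\<close> and \<open>|n|\<close> (\<open>kernel_integral_powr_le\<close>). That sum is bounded by a constant times
  its term with \<open>j = \<langle>n\<rangle>\<close> (\<open>digit_sum_le\<close>). No atomic decomposition is needed. The convergence statement is immediate
  from the estimate with \<open>k = |n|\<close>.

  Sharpness. Pass to a subsequence \<open>\<alpha>\<^sub>i\<close> along which the quotients \<open>M (l\<^sub>i) / M (h\<^sub>i)\<close>, with \<open>l\<^sub>i = \<langle>\<alpha>\<^sub>i\<rangle>\<close> and
  \<open>h\<^sub>i = |\<alpha>\<^sub>i|\<close>, decrease geometrically and \<open>h\<^sub>i\<close> increases strictly. Let the Fourier coefficients of \<open>f\<close> be
  \<open>w\<^sub>i = M (l\<^sub>i)\<^bsup>1/p-1\<^esup>\<close> on the block from \<open>M (h\<^sub>i)\<close> to \<open>M (h\<^sub>i + 1)\<close> and zero elsewhere. Summing \<open>p\<close>-th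
  powers over the blocks bounds the modulus of continuity. On the set of those \<open>x\<close> whose first
  nonzero coordinate is a \<open>1\<close> at the place \<open>l\<^sub>i\<close>, a set of measure comparable to \<open>1 / M (l\<^sub>i)\<close>, the block
  with the number \<open>i\<close> and all later ones have zero sum, so that \<open>S\<^sub>n f - f\<close> with \<open>n = \<alpha>\<^sub>i\<close> is exactly \<open>w\<^sub>i K\<^sub>n (x, 0)\<close>.
  There \<open>|K\<^sub>n (x, 0)| \<ge> M (l\<^sub>i)\<close> (\<open>norm_kernel_ge\<close>), which bounds the weak quasi-norm from below.
\<close>

section \<open>Cells of the Vilenkin group\<close>

text \<open>The setting: a Vilenkin group, not yet assumed to be bounded. The quasi-norms below are taken
  over \<open>space G\<close>, and most identities between functions hold only there.\<close>

locale vilenkin_group =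
  fixes m :: "nat \<Rightarrow> nat"
  assumes two_le_m: "m k \<ge> 2"
begin

abbreviation M :: "nat \<Rightarrow> nat" where "M \<equiv> gen_pow m"
abbreviation G :: "(nat \<Rightarrow> nat) measure" where "G \<equiv> vilenkin m"

lemma m_pos [simp]: "m k > 0" "m k \<noteq> 0"
  using two_le_m[of k] by auto

lemma M_pos [simp]: "M k > 0" "M k \<noteq> 0"
  by (induction k) auto

lemma two_M_le: "2 * M k \<le> M (Suc k)"
  using two_le_m[of k] by simp

lemma M_strict_mono: "strict_mono M"
proof (rule strict_monoI_Suc)
  show "M n < M (Suc n)" for n using two_M_le[of n] M_pos(1)[of n] by linarith
qed

lemma M_le_iff [simp]: "M i \<le> M j \<longleftrightarrow> i \<le> j"
  by (rule strict_mono_less_eq[OF M_strict_mono])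

lemma M_dvd: "i \<le> j \<Longrightarrow> M i dvd M j"
  by (induction j) (auto simp: le_Suc_eq)

lemma less_M: "k < M k"
  using gen_pow_ge[of m k, OF two_le_m] less_exp[of k] by linarith

lemma space_G: "space G = {x. \<forall>k. x k < m k}"
  by (auto simp: vilenkin_def space_PiM PiE_def space_uniform_count_measure)

lemma zero_in_space [simp]: "(\<lambda>_. 0) \<in> space G"
  by (simp add: space_G)

lemma prob_factor: "prob_space (uniform_count_measure {..<m k})"
  by (rule prob_space_uniform_count_measure) (auto simp: lessThan_empty_iff)

sublocale product_prob_space "\<lambda>k. uniform_count_measure {..<m k}" UNIV
  by (rule product_prob_spaceI) (rule prob_factor)

sublocale prob_space G
  unfolding vilenkin_def by (rule P.prob_space_axioms)

lemma measurable_coordinate [measurable]: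
  "(\<lambda>x. x k) \<in> measurable G (count_space UNIV)"
proof -
  have "(\<lambda>x. x k) \<in> measurable G (uniform_count_measure {..<m k})"
    unfolding vilenkin_def by (rule measurable_component_singleton) simp
  moreover have "(\<lambda>i. i) \<in> measurable (uniform_count_measure {..<m k}) (count_space UNIV)"
    by (auto simp: measurable_def sets_uniform_count_measure space_uniform_count_measure)
  ultimately show ?thesis by (rule measurable_compose)
qed

text \<open>The points \<open>x\<close> and \<open>y\<close> lie in the same cell of level \<open>n\<close>.\<close>

definition agree :: "nat \<Rightarrow> (nat \<Rightarrow> nat) \<Rightarrow> (nat \<Rightarrow> nat) \<Rightarrow> bool" where
  "agree n x y \<longleftrightarrow> (\<forall>j<n. x j = y j)"

lemma agree_refl [simp]: "agree n x x"
  by (simp add: agree_def)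

lemma agree_sym: "agree n x y \<Longrightarrow> agree n y x"
  by (simp add: agree_def)

lemma agree_trans: "agree n x y \<Longrightarrow> agree n y z \<Longrightarrow> agree n x z"
  by (simp add: agree_def)

lemma agree_mono: "agree n x y \<Longrightarrow> k \<le> n \<Longrightarrow> agree k x y"
  by (simp add: agree_def)

lemma agree_Suc: "agree (Suc n) x y \<longleftrightarrow> agree n x y \<and> x n = y n"
  by (auto simp: agree_def less_Suc_eq)

lemma cyl_eq: "cyl m n x = {y \<in> space G. agree n x y}"
  by (auto simp: cyl_def agree_def)

lemma cyl_eq_cyl: "agree n x y \<Longrightarrow> cyl m n x = cyl m n y"
  by (auto simp: cyl_def agree_def)

lemma sets_cyl [measurable]: "cyl m n x \<in> sets G"
  unfolding cyl_def by measurable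

lemma emeasure_cyl:
  assumes "x \<in> space G"
  shows "emeasure G (cyl m n x) = ennreal (1 / M n)"
proof -
  let ?U = "\<lambda>k. uniform_count_measure {..<m k}"
  have "cyl m n x = prod_emb UNIV ?U {..<n} (\<Pi>\<^sub>E j\<in>{..<n}. {x j})"
    by (auto simp: cyl_def vilenkin_def space_PiM prod_emb_def PiE_def restrict_def extensional_def Pi_iff)
  moreover have "emeasure (Pi\<^sub>M UNIV ?U) (prod_emb UNIV ?U {..<n} (\<Pi>\<^sub>E j\<in>{..<n}. {x j})) =
      (\<Prod>j<n. emeasure (?U j) {x j})"
    using assms by (intro emeasure_PiM_emb) (auto simp: sets_uniform_count_measure space_G)
  ultimately have "emeasure G (cyl m n x) = (\<Prod>j<n. emeasure (?U j) {x j})"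
    by (simp only: vilenkin_def)
  also have "\<dots> = (\<Prod>j<n. ennreal (1 / m j))"
    using assms by (intro prod.cong refl) (simp add: space_G emeasure_uniform_count_measure)
  also have "\<dots> = ennreal (\<Prod>j<n. 1 / m j)"
    by (rule prod_ennreal) simp
  also have "(\<Prod>j<n. 1 / m j) = 1 / M n"
    by (induction n) auto
  finally show ?thesis .
qed

lemma measure_cyl: "x \<in> space G \<Longrightarrow> measure G (cyl m n x) = 1 / M n"
  by (simp add: measure_def emeasure_cyl)

text \<open>Functions that are constant on the cells of level \<open>n\<close>. They form the finite-dimensional
  space of functions measurable with respect to the \<open>n\<close>-th \<open>\<sigma>\<close>-algebra of the filtration.\<close>

definition cell_const :: "nat \<Rightarrow> ((nat \<Rightarrow> nat) \<Rightarrow> 'a) \<Rightarrow> bool" where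
  "cell_const n g \<longleftrightarrow> (\<forall>x\<in>space G. \<forall>y\<in>space G. agree n x y \<longrightarrow> g x = g y)"

lemma cell_constD: "cell_const n g \<Longrightarrow> x \<in> space G \<Longrightarrow> y \<in> space G \<Longrightarrow> agree n x y \<Longrightarrow> g x = g y"
  unfolding cell_const_def by blast

lemma cell_constI:
  "(\<And>x y. x \<in> space G \<Longrightarrow> y \<in> space G \<Longrightarrow> agree n x y \<Longrightarrow> g x = g y) \<Longrightarrow> cell_const n g"
  unfolding cell_const_def by blast

lemma cell_const_mono: "cell_const n g \<Longrightarrow> n \<le> k \<Longrightarrow> cell_const k g"
  by (rule cell_constI, erule cell_constD, assumption, assumption, erule agree_mono)

lemma cell_const_comp:
  assumes "cell_const n g"
  shows "cell_const n (\<lambda>x. h (g x))"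
proof (rule cell_constI)
  fix x y assume "x \<in> space G" "y \<in> space G" "agree n x y"
  from cell_constD[OF assms this] show "h (g x) = h (g y)" by simp
qed

lemma cell_const_comp2:
  assumes "cell_const n g" "cell_const n g'"
  shows "cell_const n (\<lambda>x. h (g x) (g' x))"
proof (rule cell_constI)
  fix x y assume "x \<in> space G" "y \<in> space G" "agree n x y"
  from cell_constD[OF assms(1) this] cell_constD[OF assms(2) this]
  show "h (g x) (g' x) = h (g y) (g' y)" by simp
qed

lemma cell_const_sum:
  assumes "\<And>i. i \<in> A \<Longrightarrow> cell_const n (g i)"
  shows "cell_const n (\<lambda>x. \<Sum>i\<in>A. g i x)"
proof (rule cell_constI)
  fix x y assume "x \<in> space G" "y \<in> space G" "agree n x y"
  then have "g i x = g i y" if "i \<in> A" for i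
    using cell_constD[OF assms[OF that], of x y] by simp
  then show "(\<Sum>i\<in>A. g i x) = (\<Sum>i\<in>A. g i y)" by (intro sum.cong refl)
qed

lemma cell_const_indicator: "cell_const n (\<lambda>x. indicator (cyl m n y) x)"
  unfolding cell_const_def
proof (intro ballI impI)
  fix x z assume "x \<in> space G" "z \<in> space G" "agree n x z"
  then show "indicator (cyl m n y) x = indicator (cyl m n y) z"
    using agree_trans[of n y x z] agree_trans[of n y z x] agree_sym[of n x z]
    by (auto simp: cyl_eq indicator_def)
qed

lemma finite_range_cell_const:
  assumes "cell_const n g"
  shows "finite (g ` space G)"
proof (rule finite_subset)
  let ?h = "\<lambda>y k. if k < n then y k else 0"
  show "g ` space G \<subseteq> (\<lambda>y. g (?h y)) ` (\<Pi>\<^sub>E k\<in>{..<n}. {..<m k})"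
  proof (rule image_subsetI)
    fix x assume x: "x \<in> space G"
    \<comment> \<open>Setting the coordinates from \<open>n\<close> on to zero does not leave the cell.\<close>
    have "g x = g (?h (restrict x {..<n}))"
      by (rule cell_constD[OF assms x]) (use x in \<open>auto simp: space_G agree_def\<close>)
    moreover have "restrict x {..<n} \<in> (\<Pi>\<^sub>E k\<in>{..<n}. {..<m k})"
      using x by (auto simp: space_G)
    ultimately show "g x \<in> (\<lambda>y. g (?h y)) ` (\<Pi>\<^sub>E k\<in>{..<n}. {..<m k})" by blast
  qed
  show "finite ((\<lambda>y. g (?h y)) ` (\<Pi>\<^sub>E k\<in>{..<n}. {..<m k}))"
    by (intro finite_imageI finite_PiE) auto
qed

text \<open>A set that is a union of cells of level \<open>n\<close> is a union of finitely many of them.\<close>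

lemma finite_cell_cover:
  assumes A: "A \<subseteq> space G" and const: "cell_const n (\<lambda>x. x \<in> A)"
  shows "A = \<Union> (cyl m n ` A)" "finite (cyl m n ` A)"
proof -
  show "A = \<Union> (cyl m n ` A)"
  proof (intro equalityI subsetI)
    fix x assume "x \<in> A"
    then have "x \<in> cyl m n x" using A by (auto simp: cyl_eq)
    then show "x \<in> \<Union> (cyl m n ` A)" using \<open>x \<in> A\<close> by blast
  next
    fix x assume "x \<in> \<Union> (cyl m n ` A)"
    then obtain y where "y \<in> A" "x \<in> space G" "agree n y x" by (auto simp: cyl_eq)
    then show "x \<in> A" using A cell_constD[OF const, of y x] by blast
  qed
  have "cell_const n (cyl m n)"
    by (rule cell_constI) (rule cyl_eq_cyl)
  then show "finite (cyl m n ` A)"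
    by (intro finite_subset[OF image_mono[OF A]] finite_range_cell_const)
qed

lemma space_vfilt [simp]: "space (vfilt m n) = space G"
  by (auto simp: vfilt_def cyl_def space_measure_of_conv)

lemma sets_vfilt:
  "sets (vfilt m n) = {A. A \<subseteq> space G \<and> cell_const n (\<lambda>x. x \<in> A)}"
proof (intro set_eqI iffI)
  have eq: "sets (vfilt m n) = sigma_sets (space G) {cyl m n x | x. x \<in> space G}"
    unfolding vfilt_def by (rule sets_measure_of) (auto simp: cyl_def)
  fix A
  {
    assume "A \<in> sets (vfilt m n)"
    then have "A \<in> sigma_sets (space G) {cyl m n x | x. x \<in> space G}" by (simp only: eq)
    then show "A \<in> {A. A \<subseteq> space G \<and> cell_const n (\<lambda>x. x \<in> A)}"
    proof (induction rule: sigma_sets.induct)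
      case (Basic a)
      then show ?case by (auto simp: cyl_eq cell_const_def intro: agree_trans agree_sym)
    next
      case Empty
      show ?case by (simp add: cell_const_def)
    next
      case (Compl a)
      then have "cell_const n (\<lambda>x. x \<in> a)" by blast
      then show ?case unfolding cell_const_def by blast
    next
      case (Union a)
      then have "cell_const n (\<lambda>x. x \<in> a i)" "a i \<subseteq> space G" for i by blast+
      then show ?case unfolding cell_const_def by blast
    qed
  next
    assume *: "A \<in> {A. A \<subseteq> space G \<and> cell_const n (\<lambda>x. x \<in> A)}"
    then have "A = \<Union> (cyl m n ` A)" "finite (cyl m n ` A)"
      using finite_cell_cover[of A n] by auto
    moreover have "cyl m n ` A \<subseteq> sets (vfilt m n)"
      using * unfolding eq by (auto intro!: sigma_sets.Basic)
    ultimately show "A \<in> sets (vfilt m n)"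
      by (metis sets.finite_Union)
  }
qed

lemma measurable_vfilt_iff:
  fixes g :: "(nat \<Rightarrow> nat) \<Rightarrow> 'a::{topological_space, t1_space}"
  shows "g \<in> borel_measurable (vfilt m n) \<longleftrightarrow> cell_const n g"
proof
  assume g: "g \<in> borel_measurable (vfilt m n)"
  show "cell_const n g"
    unfolding cell_const_def
  proof (intro ballI impI)
    fix x y assume xy: "x \<in> space G" "y \<in> space G" "agree n x y"
    have "g -` {g x} \<inter> space (vfilt m n) \<in> sets (vfilt m n)"
      by (rule measurable_sets[OF g]) (simp add: borel_closed)
    then have "cell_const n (\<lambda>z. z \<in> g -` {g x} \<inter> space G)" by (simp only: sets_vfilt space_vfilt) blast
    from cell_constD[OF this xy] show "g x = g y" using xy by simp
  qed
next
  assume "cell_const n g"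
  then show "g \<in> borel_measurable (vfilt m n)"
  proof (intro measurableI)
    fix A :: "'a set"
    have "cell_const n (\<lambda>x. x \<in> g -` A \<inter> space G)"
      unfolding cell_const_def
    proof (intro ballI impI)
      fix x y assume xy: "x \<in> space G" "y \<in> space G" "agree n x y"
      then show "(x \<in> g -` A \<inter> space G) = (y \<in> g -` A \<inter> space G)"
        using cell_constD[OF \<open>cell_const n g\<close> xy] by simp
    qed
    then show "g -` A \<inter> space (vfilt m n) \<in> sets (vfilt m n)"
      by (simp add: sets_vfilt)
  qed simp
qed

lemma subalgebra_vfilt: "subalgebra G (vfilt m n)"
  unfolding subalgebra_def
proof (intro conjI subsetI)
  fix A assume A: "A \<in> sets (vfilt m n)"
  then have "A = \<Union> (cyl m n ` A)" "finite (cyl m n ` A)"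
    using finite_cell_cover[of A n] by (auto simp: sets_vfilt)
  moreover have "cyl m n ` A \<subseteq> sets G" by auto
  ultimately show "A \<in> sets G" by (metis sets.finite_Union)
qed simp

lemma finite_measure_subalgebra_vfilt: "finite_measure_subalgebra G (vfilt m n)"
  by unfold_locales (rule subalgebra_vfilt)

lemma cell_const_measurable:
  fixes g :: "(nat \<Rightarrow> nat) \<Rightarrow> 'a::{topological_space, t1_space}"
  assumes "cell_const n g"
  shows "g \<in> borel_measurable G"
  using measurable_from_subalg[OF subalgebra_vfilt] assms measurable_vfilt_iff by blast

lemma cell_const_bounded:
  fixes g :: "(nat \<Rightarrow> nat) \<Rightarrow> 'a::real_normed_vector"
  assumes "cell_const n g"
  obtains b where "\<And>x. x \<in> space G \<Longrightarrow> norm (g x) \<le> b"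
proof -
  have "bounded (g ` space G)"
    by (rule finite_imp_bounded[OF finite_range_cell_const[OF assms]])
  then show ?thesis using that by (auto simp: bounded_iff)
qed

lemma integrable_cell_const_mult:
  fixes g f :: "(nat \<Rightarrow> nat) \<Rightarrow> 'a::{real_normed_field, banach, second_countable_topology}"
  assumes "cell_const n g" "integrable G f"
  shows "integrable G (\<lambda>x. g x * f x)"
proof -
  obtain b where b: "\<And>x. x \<in> space G \<Longrightarrow> norm (g x) \<le> b"
    using cell_const_bounded[OF assms(1)] by blast
  note [measurable] = cell_const_measurable[OF assms(1)] borel_measurable_integrable[OF assms(2)]
  show ?thesis
  proof (rule Bochner_Integration.integrable_bound)
    show "integrable G (\<lambda>x. of_real b * f x)" using assms(2) by simp
    show "AE x in G. norm (g x * f x) \<le> norm (of_real b * f x)"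
    proof (rule AE_I2)
      fix x assume "x \<in> space G"
      then have "norm (g x) \<le> \<bar>b\<bar>" using b[of x] by linarith
      then show "norm (g x * f x) \<le> norm (of_real b * f x)"
        by (simp add: norm_mult mult_right_mono)
    qed
  qed measurable
qed

lemma integrable_cell_const:
  fixes g :: "(nat \<Rightarrow> nat) \<Rightarrow> 'a::{real_normed_field, banach, second_countable_topology}"
  assumes "cell_const n g"
  shows "integrable G g"
  using integrable_cell_const_mult[OF assms, of "\<lambda>_. 1"] by simp

end

section \<open>Digits, characters and Dirichlet kernels\<close>

context vilenkin_group
begin

lemma digit_less: "digit m n j < m j"
  by (simp add: digit_def)

lemma digit_eq_0_if_less:
  assumes "n < M k" "k \<le> j"
  shows "digit m n j = 0"
proof -
  have "n < M j" using assms(1) M_le_iff[of k j] assms(2) by linarith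
  then show ?thesis by (simp add: digit_def)
qed

lemma digit_add_high:
  assumes "r < M j" "a < m j"
  shows "digit m (a * M j + r) k = (if k < j then digit m r k else if k = j then a else 0)"
proof -
  consider "k < j" | "k = j" | "k > j" by linarith
  then show ?thesis
  proof cases
    case 1
    obtain q where q: "M j = M (Suc k) * q" using M_dvd[of "Suc k" j] 1 by (auto elim: dvdE)
    have "a * M j + r = r + M k * (m k * (q * a))" by (simp add: q mult_ac)
    then have "(a * M j + r) div M k = m k * (q * a) + r div M k"
      by (simp only: div_mult_self2 M_pos not_False_eq_True)
    with 1 show ?thesis by (simp add: digit_def)
  next
    case 2
    with assms show ?thesis by (simp add: digit_def)
  next
    case 3
    have "a * M j + r < Suc a * M j" using assms by simp
    also have "\<dots> \<le> M (Suc j)" using assms by (simp del: mult_Suc add: Suc_leI)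
    finally have "digit m (a * M j + r) k = 0" using 3 by (intro digit_eq_0_if_less[of _ "Suc j"]) auto
    with 3 show ?thesis by simp
  qed
qed

lemma digit_of_less_M_Suc: "n < M (Suc j) \<Longrightarrow> digit m n j = n div M j"
  by (simp add: digit_def less_mult_imp_div_less)

abbreviation r :: "nat \<Rightarrow> (nat \<Rightarrow> nat) \<Rightarrow> complex" where "r \<equiv> rademacher m"
abbreviation \<psi> :: "nat \<Rightarrow> (nat \<Rightarrow> nat) \<Rightarrow> complex" where "\<psi> \<equiv> psi m"

lemma rademacher_cis: "r k x = cis (2 * pi * x k / m k)"
  by (simp add: rademacher_def cis_conv_exp mult_ac)

lemma norm_rademacher [simp]: "norm (r k x) = 1"
  by (simp add: rademacher_cis)

lemma rademacher_power_m: "r k x ^ m k = 1"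
proof -
  have "r k x ^ m k = cis (2 * pi * x k)"
    by (simp only: rademacher_cis Complex.DeMoivre) simp
  also have "\<dots> = 1"
    using cis_multiple_2pi[of "x k"] by (simp add: mult_ac)
  finally show ?thesis .
qed

lemma rademacher_eq_iff:
  assumes "x \<in> space G" "t \<in> space G"
  shows "r k x = r k t \<longleftrightarrow> x k = t k"
proof -
  have "1 \<le> m k" using m_pos(1)[of k] by linarith
  from complex_root_unity_eq[OF this, of "x k" "t k"] assms
  show ?thesis by (simp add: rademacher_def space_G)
qed

lemma psi_prod:
  assumes "n < M k"
  shows "\<psi> n x = (\<Prod>j<k. r j x ^ digit m n j)"
  unfolding psi_def
proof (rule prod.mono_neutral_left)
  show "{j. digit m n j \<noteq> 0} \<subseteq> {..<k}"
    using digit_eq_0_if_less[OF assms] by (force simp: not_less[symmetric])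
qed auto

lemma norm_psi [simp]: "norm (\<psi> n x) = 1"
  by (simp add: psi_def prod_norm[symmetric] norm_power)

lemma psi_add_high:
  assumes "s < M j" "a < m j"
  shows "\<psi> (a * M j + s) x = r j x ^ a * \<psi> s x"
proof -
  have "a * M j + s < Suc a * M j" using assms by simp
  also have "\<dots> \<le> M (Suc j)" using assms by (simp del: mult_Suc add: Suc_leI)
  finally have "\<psi> (a * M j + s) x = (\<Prod>i<Suc j. r i x ^ digit m (a * M j + s) i)"
    by (rule psi_prod)
  also have "\<dots> = r j x ^ a * (\<Prod>i<j. r i x ^ digit m s i)"
    using assms by (simp add: digit_add_high mult.commute)
  finally show ?thesis using assms by (simp add: psi_prod)
qed

lemma cell_const_psi:
  assumes "n < M k"
  shows "cell_const k (\<psi> n)"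
  by (rule cell_constI) (auto simp: psi_prod[OF assms] agree_def rademacher_def intro!: prod.cong)

text \<open>The Dirichlet kernel, as a function of two points; \<open>S\<^sub>n g (x)\<close> is the integral of \<open>g\<close>
  against \<open>kernel n x\<close>.\<close>

definition kernel :: "nat \<Rightarrow> (nat \<Rightarrow> nat) \<Rightarrow> (nat \<Rightarrow> nat) \<Rightarrow> complex" where
  "kernel n x t = (\<Sum>i<n. \<psi> i x * cnj (\<psi> i t))"

text \<open>The ratio of two values of a generalized Rademacher function, a root of unity.\<close>

definition ratio :: "nat \<Rightarrow> (nat \<Rightarrow> nat) \<Rightarrow> (nat \<Rightarrow> nat) \<Rightarrow> complex" where
  "ratio j x t = r j x * cnj (r j t)"

lemma norm_ratio [simp]: "norm (ratio j x t) = 1"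
  by (simp add: ratio_def norm_mult)

lemma ratio_power_m: "ratio j x t ^ m j = 1"
  by (simp add: ratio_def power_mult_distrib rademacher_power_m flip: complex_cnj_power)

lemma ratio_eq_1_iff:
  assumes "x \<in> space G" "t \<in> space G"
  shows "ratio j x t = 1 \<longleftrightarrow> x j = t j"
proof -
  have *: "r j t * cnj (r j t) = 1"
    by (simp add: complex_norm_square[symmetric])
  have "ratio j x t = 1 \<longleftrightarrow> r j x = r j t"
    using * unfolding ratio_def by (metis mult_cancel_right mult_zero_right zero_neq_one)
  then show ?thesis using rademacher_eq_iff[OF assms] by simp
qed

lemma kernel_0 [simp]: "kernel 0 x t = 0"
  by (simp add: kernel_def)

lemma kernel_add_high:
  assumes "a < m j" "s \<le> M j"
  shows "kernel (a * M j + s) x t = kernel (a * M j) x t + ratio j x t ^ a * kernel s x t"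
proof -
  have split: "(\<Sum>i<l + s. f i) = (\<Sum>i<l. f i) + (\<Sum>i<s. f (l + i))" for l and f :: "nat \<Rightarrow> complex"
    by (induction s) (auto simp: add_ac)
  have "kernel (a * M j + s) x t =
      kernel (a * M j) x t + (\<Sum>i<s. \<psi> (a * M j + i) x * cnj (\<psi> (a * M j + i) t))"
    unfolding kernel_def by (rule split)
  also have "(\<Sum>i<s. \<psi> (a * M j + i) x * cnj (\<psi> (a * M j + i) t)) =
      (\<Sum>i<s. ratio j x t ^ a * (\<psi> i x * cnj (\<psi> i t)))"
    using assms by (intro sum.cong refl)
      (simp add: psi_add_high ratio_def power_mult_distrib mult_ac)
  finally show ?thesis by (simp add: kernel_def sum_distrib_left)
qed

lemma kernel_multiple:
  "a \<le> m j \<Longrightarrow> kernel (a * M j) x t = (\<Sum>b<a. ratio j x t ^ b) * kernel (M j) x t"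
proof (induction a)
  case (Suc a)
  then have "kernel (a * M j + M j) x t = kernel (a * M j) x t + ratio j x t ^ a * kernel (M j) x t"
    by (intro kernel_add_high) auto
  with Suc show ?case by (simp add: algebra_simps)
qed simp

lemma kernel_M:
  assumes "x \<in> space G" "t \<in> space G"
  shows "kernel (M j) x t = (if agree j x t then of_nat (M j) else 0)"
proof (induction j)
  case 0
  show ?case by (simp add: kernel_def psi_def digit_def agree_def)
next
  case (Suc j)
  have "kernel (M (Suc j)) x t = (\<Sum>b<m j. ratio j x t ^ b) * kernel (M j) x t"
    using kernel_multiple[of "m j" j] by simp
  also have "(\<Sum>b<m j. ratio j x t ^ b) = (if x j = t j then of_nat (m j) else 0)"
    using ratio_eq_1_iff[OF assms, of j] by (auto simp: geometric_sum ratio_power_m)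
  finally show ?case by (auto simp: Suc agree_Suc)
qed

text \<open>Splitting off the leading digit \<open>a\<close> of \<open>n\<close>: it contributes a sum of \<open>a\<close> roots of unity times
  the kernel of order \<open>M k\<close>, and leaves the kernel of the remainder times a factor of modulus one.\<close>

lemma kernel_bound:
  assumes "x \<in> space G" "t \<in> space G"
  shows "n < M k \<Longrightarrow> norm (kernel n x t) \<le>
    (\<Sum>j | j < k \<and> digit m n j \<noteq> 0. real (M (Suc j)) * indicator (cyl m j x) t)"
proof (induction k arbitrary: n)
  case 0
  then show ?case by simp
next
  case (Suc k)
  define a where "a = n div M k"
  define s where "s = n mod M k"
  have n: "n = a * M k + s" unfolding a_def s_def by (rule div_mult_mod_eq[symmetric])
  have s: "s < M k" by (simp add: s_def)
  have a: "a < m k" using Suc.prems by (simp add: a_def less_mult_imp_div_less)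
  have dig: "digit m n j = (if j < k then digit m s j else if j = k then a else 0)" for j
    unfolding n by (rule digit_add_high[OF s a])
  let ?f = "\<lambda>j. real (M (Suc j)) * indicator (cyl m j x) t"
  have "norm (\<Sum>b<a. ratio k x t ^ b) \<le> (\<Sum>b<a. 1)"
    by (rule order_trans[OF norm_sum]) (simp add: norm_power)
  then have le: "norm (\<Sum>b<a. ratio k x t ^ b) \<le> real (if a = 0 then 0 else m k)"
    using a by (auto intro: order_trans)
  have "norm (kernel (a * M k) x t) \<le> real (if a = 0 then 0 else m k) * norm (kernel (M k) x t)"
    using a by (simp only: kernel_multiple less_imp_le norm_mult) (rule mult_right_mono[OF le], simp)
  also have "\<dots> = (if a = 0 then 0 else ?f k)"
    using assms by (auto simp: kernel_M cyl_eq)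
  finally have 1: "norm (kernel (a * M k) x t) \<le> (if a = 0 then 0 else ?f k)" .
  have "norm (kernel n x t) \<le> norm (kernel (a * M k) x t) + norm (kernel s x t)"
    using norm_triangle_ineq[of "kernel (a * M k) x t" "ratio k x t ^ a * kernel s x t"] s
    by (simp add: n kernel_add_high[OF a] norm_mult norm_power)
  also have "\<dots> \<le> (if a = 0 then 0 else ?f k) + (\<Sum>j | j < k \<and> digit m s j \<noteq> 0. ?f j)"
    using 1 Suc.IH[OF s] by (rule add_mono)
  also have "\<dots> = (\<Sum>j | j < Suc k \<and> digit m n j \<noteq> 0. ?f j)"
  proof -
    have "{j. j < Suc k \<and> digit m n j \<noteq> 0} =
        (if a = 0 then {} else {k}) \<union> {j. j < k \<and> digit m s j \<noteq> 0}"
      by (auto simp: dig less_Suc_eq)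
    moreover have "sum f ((if a = 0 then {} else {k}) \<union> {j. j < k \<and> digit m s j \<noteq> 0}) =
        (if a = 0 then 0 else f k) + sum f {j. j < k \<and> digit m s j \<noteq> 0}" for f :: "nat \<Rightarrow> real"
      by auto
    ultimately show ?thesis by (simp only:)
  qed
  finally show ?case .
qed

section \<open>Fourier partial sums of integrable functions\<close>

lemma cell_const_kernel:
  assumes "n \<le> M k"
  shows "cell_const k (\<lambda>t. kernel n x t)"
  unfolding kernel_def using assms
  by (intro cell_const_sum cell_const_comp[of k "\<psi> _" "\<lambda>z. \<psi> _ x * cnj z"] cell_const_psi) auto

lemma integrable_mult_psi:
  "integrable G g \<Longrightarrow> integrable G (\<lambda>t. g t * cnj (\<psi> i t))"
  using integrable_cell_const_mult[of i "\<lambda>t. cnj (\<psi> i t)" g]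
  by (simp add: cell_const_comp[of i "\<psi> i" cnj] cell_const_psi less_M mult.commute)

lemma fun_sum_kernel:
  assumes "integrable G g"
  shows "fun_sum m n g x = (LINT t|G. g t * kernel n x t)"
proof -
  have "fun_sum m n g x = (\<Sum>i<n. LINT t|G. \<psi> i x * (g t * cnj (\<psi> i t)))"
    unfolding fun_sum_def fun_coeff_def by (simp add: mult.commute)
  also have "\<dots> = (LINT t|G. (\<Sum>i<n. \<psi> i x * (g t * cnj (\<psi> i t))))"
    by (rule Bochner_Integration.integral_sum[symmetric])
      (intro integrable_mult_right integrable_mult_psi assms)
  finally show ?thesis by (simp add: kernel_def sum_distrib_left mult_ac)
qed

lemma fun_sum_M:
  assumes "integrable G g" "x \<in> space G"
  shows "fun_sum m (M j) g x = of_nat (M j) * (LINT t|G. indicator (cyl m j x) t * g t)"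
proof -
  have "fun_sum m (M j) g x = (LINT t|G. of_nat (M j) * (indicator (cyl m j x) t * g t))"
    unfolding fun_sum_kernel[OF assms(1)] using assms(2)
    by (intro Bochner_Integration.integral_cong) (auto simp: kernel_M cyl_eq indicator_def)
  then show ?thesis by simp
qed

lemma integral_indicator_cyl:
  assumes "x \<in> space G"
  shows "(LINT t|G. indicator (cyl m j x) t) = (1 / of_nat (M j) :: complex)"
proof -
  have "(LINT t|G. indicator (cyl m j x) t) = (LINT t|G. complex_of_real (indicator (cyl m j x) t))"
    by (simp add: of_real_indicator)
  also have "\<dots> = complex_of_real (1 / real (M j))"
    using measure_cyl[OF assms, of j] by (subst integral_complex_of_real) simp
  finally show ?thesis by simp
qed

text \<open>The functions that are constant on the cells of level \<open>j\<close> are spanned by the first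
  \<open>M j\<close> characters.\<close>

lemma fun_sum_cell_const:
  assumes g: "cell_const j g" and x: "x \<in> space G"
  shows "fun_sum m (M j) g x = g x"
proof -
  have "(LINT t|G. indicator (cyl m j x) t * g t) = (LINT t|G. indicator (cyl m j x) t * g x)"
  proof (intro Bochner_Integration.integral_cong refl)
    fix t
    show "indicator (cyl m j x) t * g t = indicator (cyl m j x) t * g x"
      using cell_constD[OF g x, of t] by (cases "t \<in> cyl m j x") (auto simp: cyl_eq)
  qed
  also have "\<dots> = g x / of_nat (M j)"
    by (simp add: integral_indicator_cyl[OF x])
  finally show ?thesis by (simp add: fun_sum_M[OF integrable_cell_const[OF g] x])
qed

text \<open>Orthonormality is a consequence of completeness: expanding the unit vector \<open>\<psi> i\<close> in terms
  of the first \<open>M j\<close> characters, one of which is \<open>\<psi> i\<close> itself, and integrating against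
  \<open>cnj (\<psi> i)\<close> shows that all other coefficients vanish.\<close>

lemma fun_coeff_psi: "fun_coeff m (\<psi> i) l = (if i = l then 1 else 0)"
proof -
  have self: "fun_coeff m (\<psi> i) i = 1" for i
    by (simp add: fun_coeff_def complex_norm_square[symmetric] prob_space)
  show ?thesis
  proof (cases "i = l")
    case False
    define j where "j = max i l"
    have il: "i < M j" "l < M j" using less_M[of j] by (auto simp: j_def)
    note cc = cell_const_psi[OF il(1)]
    let ?c = "fun_coeff m (\<psi> i)"
    have cnj: "fun_coeff m (\<psi> k) i = cnj (?c k)" for k
      unfolding fun_coeff_def by (subst Bochner_Integration.integral_cnj[symmetric]) (simp add: mult.commute)
    have "1 = (LINT x|G. fun_sum m (M j) (\<psi> i) x * cnj (\<psi> i x))"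
      using self[of i] unfolding fun_coeff_def[of m "\<psi> i" i]
      by (simp add: fun_sum_cell_const[OF cc] cong: Bochner_Integration.integral_cong)
    also have "\<dots> = (LINT x|G. (\<Sum>k<M j. ?c k * (\<psi> k x * cnj (\<psi> i x))))"
      by (simp add: fun_sum_def sum_distrib_left sum_distrib_right mult_ac)
    also have "\<dots> = (\<Sum>k<M j. (LINT x|G. ?c k * (\<psi> k x * cnj (\<psi> i x))))"
      by (intro Bochner_Integration.integral_sum integrable_mult_right integrable_mult_psi
          integrable_cell_const cell_const_psi) auto
    also have "\<dots> = (\<Sum>k<M j. ?c k * fun_coeff m (\<psi> k) i)"
      by (simp add: fun_coeff_def)
    \<comment> \<open>Parseval's identity for the unit vector \<open>\<psi> i\<close>.\<close>
    also have "\<dots> = of_real (\<Sum>k<M j. (norm (?c k))\<^sup>2)"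
      by (simp only: cnj of_real_sum complex_norm_square)
    finally have "(\<Sum>k<M j. (norm (?c k))\<^sup>2) = 1"
      by (metis of_real_eq_1_iff)
    moreover have "(\<Sum>k<M j. (norm (?c k))\<^sup>2) \<ge> (\<Sum>k\<in>{i, l}. (norm (?c k))\<^sup>2)"
      using il by (intro sum_mono2) auto
    ultimately have "(norm (?c l))\<^sup>2 \<le> 0"
      using False self[of i] by simp
    with False show ?thesis by simp
  qed (simp add: self)
qed

end

section \<open>Partial sums of martingales\<close>

context vilenkin_group
begin

lemma fun_coeff_sum_psi:
  "fun_coeff m (\<lambda>x. \<Sum>i<n. c i * \<psi> i x) l = (if l < n then c l else 0)"
proof -
  have "fun_coeff m (\<lambda>x. \<Sum>i<n. c i * \<psi> i x) l = (LINT x|G. (\<Sum>i<n. c i * (\<psi> i x * cnj (\<psi> l x))))"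
    by (simp add: fun_coeff_def sum_distrib_left sum_distrib_right mult_ac)
  also have "\<dots> = (\<Sum>i<n. (LINT x|G. c i * (\<psi> i x * cnj (\<psi> l x))))"
    by (intro Bochner_Integration.integral_sum integrable_mult_right integrable_mult_psi
        integrable_cell_const[OF cell_const_psi[OF less_M]])
  also have "\<dots> = (\<Sum>i<n. c i * fun_coeff m (\<psi> i) l)"
    by (simp add: fun_coeff_def)
  also have "\<dots> = (if l < n then c l else 0)"
    by (simp add: fun_coeff_psi if_distrib[of "\<lambda>z. _ * z"] sum.delta cong: if_cong)
  finally show ?thesis .
qed

lemma fun_coeff_cong:
  "(\<And>x. x \<in> space G \<Longrightarrow> g x = h x) \<Longrightarrow> fun_coeff m g i = fun_coeff m h i"
  unfolding fun_coeff_def by (intro Bochner_Integration.integral_cong) auto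

lemma fun_coeff_eq_0:
  assumes "cell_const k g" "M k \<le> i"
  shows "fun_coeff m g i = 0"
proof -
  have "fun_coeff m g i = fun_coeff m (\<lambda>x. \<Sum>i<M k. fun_coeff m g i * \<psi> i x) i"
    using fun_sum_cell_const[OF assms(1)] by (intro fun_coeff_cong) (simp add: fun_sum_def)
  with assms(2) show ?thesis by (simp add: fun_coeff_sum_psi)
qed

lemma fun_sum_stable:
  assumes "cell_const k g" "M k \<le> n" "x \<in> space G"
  shows "fun_sum m n g x = g x"
proof -
  have "fun_sum m n g x = fun_sum m (M k) g x"
    unfolding fun_sum_def using assms(2) fun_coeff_eq_0[OF assms(1)]
    by (intro sum.mono_neutral_right) auto
  with fun_sum_cell_const[OF assms(1,3)] show ?thesis by simp
qed

lemma martingale_cell_const: "is_martingale m f \<Longrightarrow> cell_const n (f n)"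
  by (simp add: is_martingale_def measurable_vfilt_iff)

lemma martingale_integrable: "is_martingale m f \<Longrightarrow> integrable G (f n)"
  by (simp add: is_martingale_def)

text \<open>The martingale property, tested against functions that are constant on the cells of level \<open>n\<close>.
  The conditional expectation being defined through real and imaginary parts, all four products of
  such parts occur.\<close>

lemma martingale_integral:
  assumes f: "is_martingale m f" and le: "n \<le> k" and g: "cell_const n g"
  shows "(LINT x|G. g x * f k x) = (LINT x|G. g x * f n x)"
proof -
  interpret sub: finite_measure_subalgebra G "vfilt m n"
    by (rule finite_measure_subalgebra_vfilt)
  have AE: "AE x in G. complex_cond_exp G (vfilt m n) (f k) x = f n x"
    using f le by (simp add: is_martingale_def)
  have int: "integrable G (f k)" "integrable G (f n)"
    using f by (auto simp: is_martingale_def)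
  have real: "(LINT x|G. u x * h x) = (LINT x|G. u x * h' x)"
    if u: "cell_const n u" and h: "integrable G h" "integrable G h'"
      and eq: "AE x in G. real_cond_exp G (vfilt m n) h x = h' x" for u h h' :: "(nat \<Rightarrow> nat) \<Rightarrow> real"
  proof -
    have [measurable]: "u \<in> borel_measurable (vfilt m n)" "u \<in> borel_measurable G"
      using u measurable_vfilt_iff cell_const_measurable by blast+
    note [measurable] = borel_measurable_integrable[OF h(1)] borel_measurable_integrable[OF h(2)]
    have "(LINT x|G. u x * h x) = (LINT x|G. u x * real_cond_exp G (vfilt m n) h x)"
      by (rule sub.real_cond_exp_intg(2)[symmetric]) (use integrable_cell_const_mult[OF u h(1)] in simp_all)
    also have "\<dots> = (LINT x|G. u x * h' x)"
      using eq by (intro integral_cong_AE) auto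
    finally show ?thesis .
  qed
  have eq: "AE x in G. real_cond_exp G (vfilt m n) (\<lambda>y. Re (f k y)) x = Re (f n x)"
    "AE x in G. real_cond_exp G (vfilt m n) (\<lambda>y. Im (f k y)) x = Im (f n x)"
    using AE by (auto simp: complex_cond_exp_def complex_eq_iff)
  note R = real[OF _ integrable_Re[OF int(1)] integrable_Re[OF int(2)] eq(1)]
    and I = real[OF _ integrable_Im[OF int(1)] integrable_Im[OF int(2)] eq(2)]
  note cc = cell_const_comp[OF g, of Re] cell_const_comp[OF g, of Im]
  have ig: "integrable G (\<lambda>x. g x * f j x)" and
    parts: "integrable G (\<lambda>x. Re (g x) * Re (f j x))" "integrable G (\<lambda>x. Im (g x) * Im (f j x))"
      "integrable G (\<lambda>x. Re (g x) * Im (f j x))" "integrable G (\<lambda>x. Im (g x) * Re (f j x))"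
    if "integrable G (f j)" for j
    by (rule integrable_cell_const_mult[OF g that],
        rule integrable_cell_const_mult[OF cc(1) integrable_Re[OF that]],
        rule integrable_cell_const_mult[OF cc(2) integrable_Im[OF that]],
        rule integrable_cell_const_mult[OF cc(1) integrable_Im[OF that]],
        rule integrable_cell_const_mult[OF cc(2) integrable_Re[OF that]])
  have Re: "Re (LINT x|G. g x * f j x) = (LINT x|G. Re (g x) * Re (f j x)) - (LINT x|G. Im (g x) * Im (f j x))"
    and Im: "Im (LINT x|G. g x * f j x) = (LINT x|G. Re (g x) * Im (f j x)) + (LINT x|G. Im (g x) * Re (f j x))"
    if "integrable G (f j)" for j
    using integral_Re[OF ig[OF that]] integral_Im[OF ig[OF that]]
      Bochner_Integration.integral_diff[OF parts(1)[OF that] parts(2)[OF that]]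
      Bochner_Integration.integral_add[OF parts(3)[OF that] parts(4)[OF that]]
    by simp_all
  show ?thesis
    by (rule complex_eqI)
      (simp_all only: Re[OF int(1)] Re[OF int(2)] Im[OF int(1)] Im[OF int(2)]
        R[OF cc(1)] R[OF cc(2)] I[OF cc(1)] I[OF cc(2)])
qed

lemma mart_coeff_eq:
  assumes f: "is_martingale m f" and i: "i < M n"
  shows "mart_coeff m f i = fun_coeff m (f n) i"
  unfolding mart_coeff_def fun_coeff_def
proof (rule limI, rule tendsto_eventually)
  have "(LINT x|G. f k x * cnj (\<psi> i x)) = (LINT x|G. f n x * cnj (\<psi> i x))" if "n \<le> k" for k
    using martingale_integral[OF f that cell_const_comp[OF cell_const_psi[OF i], of cnj]]
    by (simp add: mult.commute)
  then show "\<forall>\<^sub>F k in sequentially.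
      (LINT x|G. f k x * cnj (\<psi> i x)) = (LINT x|G. f n x * cnj (\<psi> i x))"
    by (rule eventually_sequentiallyI)
qed

lemma mart_sum_eq:
  assumes f: "is_martingale m f" and "n \<le> M k"
  shows "mart_sum m n f x = fun_sum m n (f k) x"
  unfolding mart_sum_def fun_sum_def using assms(2) mart_coeff_eq[OF f, of _ k] by (intro sum.cong) auto

lemma mart_sum_M:
  assumes "is_martingale m f" "x \<in> space G"
  shows "mart_sum m (M n) f x = f n x"
  using fun_sum_cell_const[OF martingale_cell_const[OF assms(1)] assms(2), of n]
  by (simp add: mart_sum_eq[OF assms(1), of _ n])

lemma cell_const_mart_sum:
  assumes "n \<le> M k"
  shows "cell_const k (mart_sum m n f)"
  unfolding mart_sum_def using assms
  by (intro cell_const_sum cell_const_comp[of k "\<psi> _" "\<lambda>z. _ * z"] cell_const_psi) auto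

lemma mart_of_mart_sum: "mart_of m (mart_sum m n f) j x = mart_sum m (min n (M j)) f x"
proof -
  have "fun_coeff m (mart_sum m n f) i = (if i < n then mart_coeff m f i else 0)" for i
    using fun_coeff_sum_psi[of "mart_coeff m f" n i] unfolding mart_sum_def .
  then have "mart_of m (mart_sum m n f) j x =
      (\<Sum>i<M j. if i < n then mart_coeff m f i * \<psi> i x else 0)"
    unfolding mart_of_def fun_sum_def by (intro sum.cong) auto
  also have "\<dots> = (\<Sum>i | i \<in> {..<M j} \<and> i < n. mart_coeff m f i * \<psi> i x)"
    by (rule sum.inter_filter[symmetric]) simp
  also have "{i. i \<in> {..<M j} \<and> i < n} = {..<min n (M j)}" by auto
  finally show ?thesis by (simp only: mart_sum_def[of m "min n (M j)"])
qed

lemma mart_of_mart_sum_M: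
  assumes "is_martingale m f" "x \<in> space G"
  shows "mart_of m (mart_sum m (M k) f) j x = f (min k j) x"
proof -
  have "min (M k) (M j) = M (min k j)" by (simp add: min_def)
  with mart_sum_M[OF assms, of "min k j"] show ?thesis by (simp add: mart_of_mart_sum)
qed

lemma mart_sum_diff:
  assumes f: "is_martingale m f" and n: "M k \<le> n" "n \<le> M (Suc k)" and x: "x \<in> space G"
  shows "mart_sum m n f x - f k x = (LINT t|G. (f (Suc k) t - f k t) * kernel n x t)"
proof -
  note int = martingale_integrable[OF f]
  have ik: "integrable G (\<lambda>t. f j t * kernel n x t)" for j
    using integrable_cell_const_mult[OF cell_const_kernel[OF n(2)] int[of j]] by (simp add: mult.commute)
  have "f k x = (LINT t|G. f k t * kernel n x t)"
    using fun_sum_stable[OF martingale_cell_const[OF f] n(1) x] by (simp add: fun_sum_kernel[OF int])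
  moreover have "mart_sum m n f x = (LINT t|G. f (Suc k) t * kernel n x t)"
    by (simp add: mart_sum_eq[OF f n(2)] fun_sum_kernel[OF int])
  ultimately show ?thesis
    using Bochner_Integration.integral_diff[OF ik[of "Suc k"] ik[of k]] by (simp add: left_diff_distrib)
qed

end

section \<open>Powers of extended nonnegative reals\<close>

lemma ennreal_powr_top [simp]: "ennreal_powr \<top> a = \<top>"
  by (simp add: ennreal_powr_def)

lemma ennreal_powr_ennreal: "0 \<le> x \<Longrightarrow> ennreal_powr (ennreal x) a = ennreal (x powr a)"
  by (simp add: ennreal_powr_def)

lemma ennreal_powr_0 [simp]: "ennreal_powr 0 a = 0"
  using ennreal_powr_ennreal[of 0 a] by simp

lemma ennreal_powr_mono:
  assumes "x \<le> y" "0 \<le> a"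
  shows "ennreal_powr x a \<le> ennreal_powr y a"
  using assms by (cases x; cases y) (auto simp: ennreal_powr_ennreal powr_mono2 top_unique)

lemma ennreal_powr_powr:
  assumes "0 < a"
  shows "ennreal_powr (ennreal_powr x a) (1 / a) = x"
  using assms by (cases x) (auto simp: ennreal_powr_ennreal powr_powr)

lemma ennreal_powr_mult:
  assumes "0 < c"
  shows "ennreal_powr (ennreal c * x) a = ennreal (c powr a) * ennreal_powr x a"
  using assms
  by (cases x) (auto simp: ennreal_powr_ennreal powr_mult ennreal_mult_top simp flip: ennreal_mult)

lemma powr_add_le:
  fixes x y p :: real
  assumes "0 \<le> x" "0 \<le> y" "0 < p" "p \<le> 1"
  shows "(x + y) powr p \<le> x powr p + y powr p"
proof (cases "x + y = 0")
  case False
  then have pos: "0 < x + y" using assms by linarith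
  have le: "z \<le> z powr p" if "0 \<le> z" "z \<le> 1" for z :: real
    using powr_mono'[of p 1 z] that assms by simp
  have "1 = x / (x + y) + y / (x + y)"
    using pos by (simp flip: add_divide_distrib)
  also have "\<dots> \<le> (x / (x + y)) powr p + (y / (x + y)) powr p"
    using assms pos by (intro add_mono le) auto
  also have "\<dots> = (x powr p + y powr p) / (x + y) powr p"
    using assms pos by (simp add: powr_divide add_divide_distrib)
  finally show ?thesis using pos by (simp add: pos_le_divide_eq)
qed (use assms in auto)

lemma ennreal_powr_add_le:
  assumes "0 < p" "p \<le> 1"
  shows "ennreal_powr (x + y) p \<le> ennreal_powr x p + ennreal_powr y p"
  using assms
  by (cases x; cases y)
    (auto simp: ennreal_powr_ennreal powr_add_le simp flip: ennreal_plus)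

lemma ennreal_powr_sum_le:
  assumes "0 < p" "p \<le> 1"
  shows "ennreal_powr (\<Sum>i\<in>A. u i) p \<le> (\<Sum>i\<in>A. ennreal_powr (u i) p)"
  by (induction A rule: infinite_finite_induct)
    (auto intro: order_trans[OF ennreal_powr_add_le[OF assms]] add_left_mono)

lemma ennreal_powr_SUP_le:
  assumes "0 < p" "\<And>n. ennreal_powr (u n) p \<le> b"
  shows "ennreal_powr (SUP n. u n) p \<le> b"
proof -
  have "u n \<le> ennreal_powr b (1 / p)" for n
    using ennreal_powr_mono[OF assms(2), of "1 / p"] ennreal_powr_powr[OF assms(1)] assms(1) by simp
  then have "(SUP n. u n) \<le> ennreal_powr b (1 / p)" by (rule SUP_least)
  then have "ennreal_powr (SUP n. u n) p \<le> ennreal_powr (ennreal_powr b (1 / p)) p"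
    using assms(1) by (intro ennreal_powr_mono) auto
  also have "\<dots> = b"
    using ennreal_powr_powr[of "1 / p" b] assms(1) by simp
  finally show ?thesis .
qed

lemma measurable_ennreal_powr [measurable]:
  assumes [measurable]: "u \<in> borel_measurable N"
  shows "(\<lambda>x. ennreal_powr (u x) a) \<in> borel_measurable N"
  unfolding ennreal_powr_def by measurable

section \<open>Boundedness of partial sums\<close>

context vilenkin_group
begin

text \<open>On functions that are constant on the cells of a fixed level \<open>J\<close>, the integral over a set is
  controlled by the \<open>p\<close>-th power integral, because no cell can carry more than the latter.\<close>

lemma integral_cell_powr_le:
  fixes h :: "(nat \<Rightarrow> nat) \<Rightarrow> complex"
  assumes h: "cell_const J h" and j: "j \<le> J" and x: "x \<in> space G" and p: "0 < p" "p \<le> 1"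
  shows "ennreal_powr (\<integral>\<^sup>+ t. ennreal (norm (h t)) * indicator (cyl m j x) t \<partial>G) p
    \<le> ennreal (real (M J) powr (1 - p)) *
      (\<integral>\<^sup>+ t. ennreal (norm (h t) powr p) * indicator (cyl m j x) t \<partial>G)"
proof (cases "\<integral>\<^sup>+ t. ennreal (norm (h t) powr p) * indicator (cyl m j x) t \<partial>G")
  case top
  then show ?thesis by (simp add: ennreal_mult_top)
next
  case (real a)
  note [measurable] = cell_const_measurable[OF h]
  define C where "C = (a * M J) powr ((1 - p) / p)"
  have bound: "norm (h t) \<le> C * norm (h t) powr p" if t: "t \<in> cyl m j x" for t
  proof (cases "h t = 0")
    case False
    let ?y = "norm (h t) powr p"
    have tG: "t \<in> space G" and tx: "agree j x t" using t by (auto simp: cyl_eq)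
    \<comment> \<open>The cell of level \<open>J\<close> around \<open>t\<close> alone contributes \<open>?y / M J\<close> to the integral \<open>a\<close>.\<close>
    have "ennreal (?y * (1 / M J)) = (\<integral>\<^sup>+ s. ennreal ?y * indicator (cyl m J t) s \<partial>G)"
      by (subst ennreal_mult) (simp_all add: nn_integral_cmult_indicator emeasure_cyl[OF tG])
    also have "\<dots> \<le> (\<integral>\<^sup>+ s. ennreal (norm (h s) powr p) * indicator (cyl m j x) s \<partial>G)"
    proof (rule nn_integral_mono)
      fix s
      show "ennreal ?y * indicator (cyl m J t) s \<le> ennreal (norm (h s) powr p) * indicator (cyl m j x) s"
        using cell_constD[OF h tG, of s] agree_trans[OF tx agree_mono[OF _ j, of t s]]
        by (cases "s \<in> cyl m J t") (auto simp: cyl_eq)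
    qed
    finally have "?y * (1 / M J) \<le> a" using real by (simp add: real(2))
    then have "?y \<le> a * M J" by (simp add: field_simps)
    then have "?y powr ((1 - p) / p) \<le> C"
      unfolding C_def using p by (intro powr_mono2) auto
    then have "norm (h t) powr (1 - p) \<le> C"
      using p by (simp add: powr_powr)
    then have "norm (h t) powr (1 - p) * ?y \<le> C * ?y"
      by (rule mult_right_mono) simp
    then show ?thesis using False by (simp flip: powr_add)
  qed simp
  have "(\<integral>\<^sup>+ t. ennreal (norm (h t)) * indicator (cyl m j x) t \<partial>G) \<le>
      (\<integral>\<^sup>+ t. ennreal C * (ennreal (norm (h t) powr p) * indicator (cyl m j x) t) \<partial>G)"
    using bound
    by (intro nn_integral_mono) (auto simp: indicator_def C_def simp flip: ennreal_mult intro!: ennreal_leI)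
  also have "\<dots> = ennreal C * ennreal a"
    by (simp add: nn_integral_cmult real)
  also have "\<dots> = ennreal (C * a)"
    using real by (simp add: C_def flip: ennreal_mult)
  finally have "ennreal_powr (\<integral>\<^sup>+ t. ennreal (norm (h t)) * indicator (cyl m j x) t \<partial>G) p
      \<le> ennreal_powr (ennreal (C * a)) p"
    using p by (intro ennreal_powr_mono) auto
  also have "\<dots> = ennreal ((C * a) powr p)"
    using real by (intro ennreal_powr_ennreal) (simp add: C_def)
  also have "(C * a) powr p = real (M J) powr (1 - p) * a"
  proof (cases "a = 0")
    case False
    then have "C powr p = a powr (1 - p) * real (M J) powr (1 - p)"
      using real p by (simp add: C_def powr_powr powr_mult)
    moreover have "a powr (1 - p) * a powr p = a"
      using real False by (simp flip: powr_add)
    ultimately show ?thesis using real by (simp add: powr_mult C_def mult_ac)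
  qed (use p in simp)
  also have "ennreal (real (M J) powr (1 - p) * a) = ennreal (real (M J) powr (1 - p)) * ennreal a"
    using real by (simp add: ennreal_mult)
  finally show ?thesis by (simp add: real(2))
qed

lemma measurable_cell_product:
  fixes u :: "(nat \<Rightarrow> nat) \<Rightarrow> ennreal"
  assumes u: "u \<in> borel_measurable G"
  shows "(\<lambda>(x, t). u t * indicator (cyl m j x) t) \<in> borel_measurable (G \<Otimes>\<^sub>M G)"
proof -
  have "{z \<in> space (G \<Otimes>\<^sub>M G). fst z i = snd z i} \<in> sets (G \<Otimes>\<^sub>M G)" for i
  proof -
    have "{z \<in> space (G \<Otimes>\<^sub>M G). fst z i = snd z i} =
        (\<Union>a. {x \<in> space G. x i = a} \<times> {t \<in> space G. t i = a})"
      by (auto simp: space_pair_measure)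
    also have "\<dots> \<in> sets (G \<Otimes>\<^sub>M G)"
      by (intro sets.countable_UN image_subsetI pair_measureI) measurable
    finally show ?thesis .
  qed
  then have [measurable]: "{z \<in> space (G \<Otimes>\<^sub>M G). \<forall>i\<in>{..<j}. fst z i = snd z i} \<in> sets (G \<Otimes>\<^sub>M G)"
    by (intro sets.sets_Collect_finite_All) auto
  have [measurable]: "(\<lambda>z. u (snd z)) \<in> borel_measurable (G \<Otimes>\<^sub>M G)"
    by (rule measurable_compose[OF measurable_snd u])
  have "(\<lambda>z. u (snd z) * indicator {z \<in> space (G \<Otimes>\<^sub>M G). \<forall>i\<in>{..<j}. fst z i = snd z i} z)
      \<in> borel_measurable (G \<Otimes>\<^sub>M G)"
    by measurable
  moreover have "(case z of (x, t) \<Rightarrow> u t * indicator (cyl m j x) t) =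
      u (snd z) * indicator {z \<in> space (G \<Otimes>\<^sub>M G). \<forall>i\<in>{..<j}. fst z i = snd z i} z"
    if "z \<in> space (G \<Otimes>\<^sub>M G)" for z
    using that by (cases z) (auto simp: space_pair_measure cyl_def indicator_def)
  ultimately show ?thesis by (subst measurable_cong)
qed

lemma nn_integral_cell_average:
  assumes u: "u \<in> borel_measurable G"
  shows "(\<integral>\<^sup>+ x. (\<integral>\<^sup>+ t. u t * indicator (cyl m j x) t \<partial>G) \<partial>G) = ennreal (1 / M j) * (\<integral>\<^sup>+ t. u t \<partial>G)"
proof -
  interpret pair_sigma_finite G G ..
  have "(\<integral>\<^sup>+ x. (\<integral>\<^sup>+ t. u t * indicator (cyl m j x) t \<partial>G) \<partial>G) =
      (\<integral>\<^sup>+ t. (\<integral>\<^sup>+ x. u t * indicator (cyl m j x) t \<partial>G) \<partial>G)"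
    using Fubini'[OF measurable_cell_product[OF u, of j]] by simp
  also have "\<dots> = (\<integral>\<^sup>+ t. (\<integral>\<^sup>+ x. u t * indicator (cyl m j t) x \<partial>G) \<partial>G)"
    by (intro nn_integral_cong) (auto simp: cyl_def indicator_def)
  also have "\<dots> = (\<integral>\<^sup>+ t. ennreal (1 / M j) * u t \<partial>G)"
    by (intro nn_integral_cong) (simp add: nn_integral_cmult_indicator emeasure_cyl mult.commute)
  finally show ?thesis by (simp add: nn_integral_cmult u)
qed

lemma kernel_integral_le:
  fixes h :: "(nat \<Rightarrow> nat) \<Rightarrow> complex"
  assumes h: "cell_const J h" and n: "n < M J" and x: "x \<in> space G"
  shows "ennreal (norm (LINT t|G. h t * kernel n x t)) \<le>
    (\<Sum>j | j < J \<and> digit m n j \<noteq> 0.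
      ennreal (M (Suc j)) * (\<integral>\<^sup>+ t. ennreal (norm (h t)) * indicator (cyl m j x) t \<partial>G))"
proof -
  let ?D = "{j. j < J \<and> digit m n j \<noteq> 0}"
  note [measurable] = cell_const_measurable[OF h]
  have cc: "cell_const J (\<lambda>t. h t * kernel n x t)"
    by (rule cell_const_comp2[OF h cell_const_kernel]) (use n in simp)
  have "ennreal (norm (LINT t|G. h t * kernel n x t)) \<le> (\<integral>\<^sup>+ t. ennreal (norm (h t * kernel n x t)) \<partial>G)"
    by (rule integral_norm_bound_ennreal[OF integrable_cell_const[OF cc]])
  also have "\<dots> \<le> (\<integral>\<^sup>+ t. (\<Sum>j\<in>?D. ennreal (M (Suc j)) * (ennreal (norm (h t)) * indicator (cyl m j x) t)) \<partial>G)"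
  proof (rule nn_integral_mono)
    fix t assume "t \<in> space G"
    from kernel_bound[OF x this n]
    have "norm (h t * kernel n x t) \<le>
        norm (h t) * (\<Sum>j\<in>?D. real (M (Suc j)) * indicator (cyl m j x) t)"
      unfolding norm_mult by (rule mult_left_mono) simp
    then have "ennreal (norm (h t * kernel n x t)) \<le>
        ennreal (\<Sum>j\<in>?D. real (M (Suc j)) * (norm (h t) * indicator (cyl m j x) t))"
      by (intro ennreal_leI) (simp add: sum_distrib_left mult_ac)
    also have "\<dots> = (\<Sum>j\<in>?D. ennreal (real (M (Suc j)) * (norm (h t) * indicator (cyl m j x) t)))"
      by (rule sum_ennreal[symmetric]) auto
    also have "\<dots> = (\<Sum>j\<in>?D. ennreal (M (Suc j)) * (ennreal (norm (h t)) * indicator (cyl m j x) t))"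
      by (intro sum.cong refl) (simp add: ennreal_mult ennreal_indicator del: gen_pow.simps)
    finally show "ennreal (norm (h t * kernel n x t)) \<le> \<dots>" .
  qed
  also have "\<dots> = (\<Sum>j\<in>?D. ennreal (M (Suc j)) * (\<integral>\<^sup>+ t. ennreal (norm (h t)) * indicator (cyl m j x) t \<partial>G))"
    by (subst nn_integral_sum) (auto simp: nn_integral_cmult simp del: gen_pow.simps)
  finally show ?thesis .
qed

text \<open>After the \<open>p\<close>-th power has been moved inside the integrals over cells, Fubini's theorem turns
  each average over cells of level \<open>j\<close> into a factor \<open>1 / M j\<close>.\<close>

lemma kernel_integral_powr_le:
  fixes h :: "(nat \<Rightarrow> nat) \<Rightarrow> complex"
  assumes h: "cell_const J h" and n: "n < M J" and p: "0 < p" "p \<le> 1"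
  shows "(\<integral>\<^sup>+ x. ennreal_powr (ennreal (norm (LINT t|G. h t * kernel n x t))) p \<partial>G) \<le>
    ennreal (real (M J) powr (1 - p) *
      (\<Sum>j | j < J \<and> digit m n j \<noteq> 0. real (M (Suc j)) powr p / real (M j))) *
    (\<integral>\<^sup>+ t. ennreal (norm (h t) powr p) \<partial>G)"
proof -
  let ?D = "{j. j < J \<and> digit m n j \<noteq> 0}"
  let ?v = "\<lambda>t. ennreal (norm (h t) powr p)"
  let ?c = "\<lambda>j. ennreal (real (M (Suc j)) powr p * real (M J) powr (1 - p))"
  note [measurable] = cell_const_measurable[OF h]
  have meas: "(\<lambda>x. \<integral>\<^sup>+ t. ?v t * indicator (cyl m j x) t \<partial>G) \<in> borel_measurable G" for j
    by (rule borel_measurable_nn_integral[OF measurable_cell_product]) measurable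
  have "(\<integral>\<^sup>+ x. ennreal_powr (ennreal (norm (LINT t|G. h t * kernel n x t))) p \<partial>G) \<le>
      (\<integral>\<^sup>+ x. (\<Sum>j\<in>?D. ?c j * (\<integral>\<^sup>+ t. ?v t * indicator (cyl m j x) t \<partial>G)) \<partial>G)"
  proof (rule nn_integral_mono)
    fix x assume x: "x \<in> space G"
    let ?I = "\<lambda>j. \<integral>\<^sup>+ t. ennreal (norm (h t)) * indicator (cyl m j x) t \<partial>G"
    have "ennreal_powr (ennreal (norm (LINT t|G. h t * kernel n x t))) p \<le>
        ennreal_powr (\<Sum>j\<in>?D. ennreal (M (Suc j)) * ?I j) p"
      by (rule ennreal_powr_mono[OF kernel_integral_le[OF h n x]]) (use p in simp)
    also have "\<dots> \<le> (\<Sum>j\<in>?D. ennreal_powr (ennreal (M (Suc j)) * ?I j) p)"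
      by (rule ennreal_powr_sum_le[OF p])
    also have "\<dots> \<le> (\<Sum>j\<in>?D. ?c j * (\<integral>\<^sup>+ t. ?v t * indicator (cyl m j x) t \<partial>G))"
    proof (rule sum_mono)
      fix j assume j: "j \<in> ?D"
      have "ennreal_powr (ennreal (M (Suc j)) * ?I j) p = ennreal (real (M (Suc j)) powr p) * ennreal_powr (?I j) p"
        by (rule ennreal_powr_mult) (simp del: gen_pow.simps)
      also have "\<dots> \<le> ennreal (real (M (Suc j)) powr p) *
          (ennreal (real (M J) powr (1 - p)) * (\<integral>\<^sup>+ t. ?v t * indicator (cyl m j x) t \<partial>G))"
        using j by (intro mult_left_mono integral_cell_powr_le[OF h _ x p]) auto
      finally show "ennreal_powr (ennreal (M (Suc j)) * ?I j) p \<le>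
          ?c j * (\<integral>\<^sup>+ t. ?v t * indicator (cyl m j x) t \<partial>G)"
        by (simp add: ennreal_mult mult.assoc del: gen_pow.simps)
    qed
    finally show "ennreal_powr (ennreal (norm (LINT t|G. h t * kernel n x t))) p \<le> \<dots>" .
  qed
  also have "\<dots> = (\<Sum>j\<in>?D. ?c j * (ennreal (1 / M j) * (\<integral>\<^sup>+ t. ?v t \<partial>G)))"
    using meas by (subst nn_integral_sum) (auto simp: nn_integral_cmult nn_integral_cell_average
      simp del: gen_pow.simps)
  also have "\<dots> = (\<Sum>j\<in>?D. ennreal (real (M (Suc j)) powr p * real (M J) powr (1 - p) * (1 / M j))) *
      (\<integral>\<^sup>+ t. ?v t \<partial>G)"
    unfolding sum_distrib_right by (intro sum.cong refl) (simp only: ennreal_mult mult.assoc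
      mult_nonneg_nonneg powr_ge_zero of_nat_0_le_iff divide_nonneg_nonneg zero_le_one)
  also have "(\<Sum>j\<in>?D. ennreal (real (M (Suc j)) powr p * real (M J) powr (1 - p) * (1 / M j))) =
      ennreal (real (M J) powr (1 - p) * (\<Sum>j\<in>?D. real (M (Suc j)) powr p / real (M j)))"
    by (subst sum_ennreal) (auto simp: sum_distrib_left mult_ac simp del: gen_pow.simps)
  finally show ?thesis .
qed

section \<open>The smallest and the largest index of a nonzero digit\<close>

lemma ex_M_bounds:
  assumes "n > 0"
  obtains j where "M j \<le> n" "n < M (Suc j)"
proof -
  define j where "j = (GREATEST j. M j \<le> n)"
  have bounded: "j \<le> n" if "M j \<le> n" for j
    using less_M[of j] that by linarith
  have "M j \<le> n" unfolding j_def by (rule GreatestI_nat[where P = "\<lambda>j. M j \<le> n" and k = 0, OF _ bounded]) (use assms in simp)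
  moreover have "n < M (Suc j)"
  proof (rule ccontr)
    assume "\<not> n < M (Suc j)"
    then have "Suc j \<le> j" unfolding j_def by (intro Greatest_le_nat[where P = "\<lambda>j. M j \<le> n", OF _ bounded]) simp
    then show False by simp
  qed
  ultimately show thesis by (rule that)
qed

lemma high_idx_eqI:
  assumes "M j \<le> n" "n < M (Suc j)"
  shows "high_idx m n = j"
  unfolding high_idx_def
proof (rule Max_eqI)
  show "finite {j. digit m n j \<noteq> 0}" by (rule finite_digits[OF two_le_m])
  show "i \<le> j" if "i \<in> {j. digit m n j \<noteq> 0}" for i
    using digit_eq_0_if_less[OF assms(2), of i] that by (force simp: not_less_eq_eq)
  have "n div M j \<noteq> 0" using assms(1) by (simp add: div_eq_0_iff)
  then show "j \<in> {j. digit m n j \<noteq> 0}" using digit_of_less_M_Suc[OF assms(2)] by simp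
qed

lemma high_idx_bounds:
  assumes "n > 0"
  shows "M (high_idx m n) \<le> n" "n < M (Suc (high_idx m n))"
proof -
  obtain j where "M j \<le> n" "n < M (Suc j)" using ex_M_bounds[OF assms] by blast
  with high_idx_eqI[OF this] show "M (high_idx m n) \<le> n" "n < M (Suc (high_idx m n))" by simp_all
qed

lemma low_idx_digit:
  assumes "n > 0"
  shows "digit m n (low_idx m n) \<noteq> 0" "digit m n j \<noteq> 0 \<Longrightarrow> low_idx m n \<le> j"
    "low_idx m n \<le> high_idx m n"
proof -
  let ?D = "{j. digit m n j \<noteq> 0}"
  have fin: "finite ?D" by (rule finite_digits[OF two_le_m])
  have ne: "?D \<noteq> {}"
  proof
    assume "?D = {}"
    with digit_expansion[of m n, OF two_le_m] have "n = (\<Sum>j\<in>{}. digit m n j * M j)" by (simp only:)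
    with assms show False by simp
  qed
  from Min_in[OF fin ne] show "digit m n (low_idx m n) \<noteq> 0" by (simp add: low_idx_def)
  then show "low_idx m n \<le> high_idx m n" unfolding high_idx_def by (intro Max_ge fin) simp
  show "digit m n j \<noteq> 0 \<Longrightarrow> low_idx m n \<le> j" unfolding low_idx_def by (intro Min_le fin) simp
qed

lemma two_power_M_le: "2 ^ i * M j \<le> M (j + i)"
proof (induction i)
  case (Suc i)
  have "2 ^ Suc i * M j \<le> 2 * M (j + i)" using Suc by simp
  also have "\<dots> \<le> M (Suc (j + i))" by (rule two_M_le)
  finally show ?case by (simp del: gen_pow.simps)
qed simp

end

section \<open>The estimate of the rate of approximation\<close>

context vilenkin_group
begin

text \<open>Here \<open>\<theta> = 2 powr (p - 1)\<close> is the ratio of a geometric series that dominates the sum, because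
  \<open>M j \<ge> 2 ^ (j - N) * M N\<close> and \<open>p - 1 < 0\<close>.\<close>

lemma digit_sum_le:
  assumes B: "\<And>k. m k \<le> B" and p: "0 < p" "p < 1" and n: "n > 0"
  defines "H \<equiv> high_idx m n" and "N \<equiv> low_idx m n"
  shows "real (M (Suc H)) powr (1 - p) *
      (\<Sum>j | j < Suc H \<and> digit m n j \<noteq> 0. real (M (Suc j)) powr p / real (M j))
    \<le> real B / (1 - 2 powr (p - 1)) * (real (M H) / real (M N)) powr (1 - p)"
proof -
  let ?D = "{j. j < Suc H \<and> digit m n j \<noteq> 0}"
  define \<theta> :: real where "\<theta> = 2 powr (p - 1)"
  have \<theta>: "0 < \<theta>" "\<theta> < 1" using p powr_less_mono[of "p - 1" 0 2] by (auto simp: \<theta>_def)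
  have MS: "real (M (Suc j)) \<le> real B * real (M j)" for j
    using B[of j] by (simp add: mult_right_mono)
  have summand: "real (M (Suc j)) powr p / real (M j) \<le> real B powr p * (real (M N) powr (p - 1) * \<theta> ^ (j - N))"
    if "j \<in> ?D" for j
  proof -
    have "N \<le> j" unfolding N_def using that low_idx_digit(2)[OF n] by auto
    with two_power_M_le[of "j - N" N] have "2 ^ (j - N) * M N \<le> M j" by simp
    then have "real (2 ^ (j - N) * M N) \<le> real (M j)" by (simp only: of_nat_le_iff)
    then have *: "2 ^ (j - N) * real (M N) \<le> real (M j)" by simp
    have "real (M (Suc j)) powr p / real (M j) \<le> (real B * real (M j)) powr p / real (M j)"
      using p MS[of j] by (intro divide_right_mono powr_mono2) auto
    also have "\<dots> = real B powr p * real (M j) powr (p - 1)"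
      by (simp add: powr_mult powr_diff)
    also have "real (M j) powr (p - 1) \<le> (2 ^ (j - N) * real (M N)) powr (p - 1)"
      using p * by (intro powr_mono2') auto
    also have "\<dots> = real (M N) powr (p - 1) * \<theta> ^ (j - N)"
      by (simp add: \<theta>_def powr_mult powr_powr mult.commute flip: powr_realpow)
    finally show ?thesis by (simp add: mult_left_mono)
  qed
  have geo: "(\<Sum>j\<in>?D. \<theta> ^ (j - N)) \<le> 1 / (1 - \<theta>)"
  proof -
    have "(\<Sum>j\<in>?D. \<theta> ^ (j - N)) \<le> (\<Sum>j\<in>{N..<N + Suc H}. \<theta> ^ (j - N))"
      using \<theta> low_idx_digit(2)[OF n] by (intro sum_mono2) (auto simp: N_def)
    also have "\<dots> = (\<Sum>i<Suc H. \<theta> ^ i)"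
      by (rule sum.reindex_bij_witness[of _ "\<lambda>i. i + N" "\<lambda>j. j - N"]) auto
    also have "\<dots> = (1 - \<theta> ^ Suc H) / (1 - \<theta>)"
      using \<theta> by (subst sum_gp_strict) auto
    also have "\<dots> \<le> 1 / (1 - \<theta>)"
      using \<theta> by (intro divide_right_mono) auto
    finally show ?thesis .
  qed
  have "(\<Sum>j\<in>?D. real (M (Suc j)) powr p / real (M j)) \<le>
      (\<Sum>j\<in>?D. real B powr p * (real (M N) powr (p - 1) * \<theta> ^ (j - N)))"
    by (rule sum_mono[OF summand])
  also have "\<dots> = real B powr p * real (M N) powr (p - 1) * (\<Sum>j\<in>?D. \<theta> ^ (j - N))"
    by (simp add: sum_distrib_left mult_ac)
  also have "\<dots> \<le> real B powr p * real (M N) powr (p - 1) * (1 / (1 - \<theta>))"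
    by (rule mult_left_mono[OF geo]) simp
  finally have S: "(\<Sum>j\<in>?D. real (M (Suc j)) powr p / real (M j)) \<le>
      real B powr p * real (M N) powr (p - 1) * (1 / (1 - \<theta>))" .
  have "B > 0" using B[of 0] m_pos[of 0] by linarith
  have "real (M (Suc H)) powr (1 - p) * (\<Sum>j\<in>?D. real (M (Suc j)) powr p / real (M j)) \<le>
      (real B * real (M H)) powr (1 - p) * (real B powr p * real (M N) powr (p - 1) * (1 / (1 - \<theta>)))"
    using p MS[of H] by (intro mult_mono S powr_mono2 sum_nonneg) auto
  also have "\<dots> = (real B powr (1 - p) * real B powr p) * (1 / (1 - \<theta>)) *
      (real (M H) powr (1 - p) * real (M N) powr (p - 1))"
    by (simp add: powr_mult)
  also have "real B powr (1 - p) * real B powr p = real B"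
    using \<open>B > 0\<close> by (simp flip: powr_add)
  also have "real (M H) powr (1 - p) * real (M N) powr (p - 1) = (real (M H) / real (M N)) powr (1 - p)"
    using powr_minus_divide[of "real (M N)" "1 - p"] by (simp add: powr_divide)
  finally show ?thesis by (simp add: \<theta>_def)
qed

lemma modulus_process:
  assumes "is_martingale m f" "x \<in> space G"
  shows "f j x - mart_of m (mart_sum m (M k) f) j x = f j x - f (min k j) x"
  using mart_of_mart_sum_M[OF assms] by simp

lemma measurable_modulus_process:
  assumes "is_martingale m f"
  shows "(\<lambda>x. f j x - mart_of m (mart_sum m (M k) f) j x) \<in> borel_measurable G"
proof -
  have [measurable]: "f j \<in> borel_measurable G" for j
    by (rule cell_const_measurable[OF martingale_cell_const[OF assms]])
  have "(\<lambda>x. f j x - f (min k j) x) \<in> borel_measurable G" by measurable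
  then show ?thesis by (subst measurable_cong[OF modulus_process[OF assms]])
qed

text \<open>The difference \<open>S\<^sub>n f - f\<close> is the integral of the single martingale increment \<open>f\<^bsub>k+1\<^esub> - f\<^sub>k\<close>
  against the Dirichlet kernel, minus \<open>f - S\<^bsub>M k\<^esub> f\<close>; as a martingale it vanishes up to the index \<open>k\<close>.
  That increment is itself bounded by the maximal function of \<open>f - S\<^bsub>M k\<^esub> f\<close>.\<close>

lemma maximal_sum_diff_le:
  assumes f: "is_martingale m f" and n: "M k \<le> n" "n \<le> M (Suc k)" and x: "x \<in> space G"
  shows "maximal (sum_diff m n f) x \<le>
    ennreal (norm (LINT t|G. (f (Suc k) t - f k t) * kernel n x t)) +
    maximal (\<lambda>j x. f j x - mart_of m (mart_sum m (M k) f) j x) x"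
  unfolding maximal_def[of "sum_diff m n f"]
proof (rule SUP_least)
  fix j
  let ?W = "\<lambda>j x. f j x - mart_of m (mart_sum m (M k) f) j x"
  let ?S = "LINT t|G. (f (Suc k) t - f k t) * kernel n x t"
  have W: "?W j x = f j x - f (min k j) x" by (rule modulus_process[OF f x])
  have "norm (sum_diff m n f j x) \<le> norm ?S + norm (?W j x)"
  proof (cases "j \<le> k")
    case True
    then have "M j \<le> n" using n(1) M_le_iff[of j k] by linarith
    then have "sum_diff m n f j x = 0"
      by (simp add: sum_diff_def mart_of_mart_sum min_absorb2 mart_sum_M[OF f x])
    then show ?thesis by (simp add: add_nonneg_nonneg)
  next
    case False
    then have "n \<le> M j" using n(2) M_le_iff[of "Suc k" j] by linarith
    then have "sum_diff m n f j x = (mart_sum m n f x - f k x) - (f j x - f k x)"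
      by (simp add: sum_diff_def mart_of_mart_sum min_absorb1)
    also have "\<dots> = ?S - ?W j x"
      using False by (simp only: mart_sum_diff[OF f n x] W) (simp add: min_def)
    finally show ?thesis using norm_triangle_ineq4[of ?S "?W j x"] by simp
  qed
  then have "ennreal (norm (sum_diff m n f j x)) \<le> ennreal (norm ?S) + ennreal (norm (?W j x))"
    by (simp add: ennreal_leI flip: ennreal_plus)
  also have "\<dots> \<le> ennreal (norm ?S) + maximal ?W x"
    unfolding maximal_def by (intro add_left_mono SUP_upper) simp
  finally show "ennreal (norm (sum_diff m n f j x)) \<le> \<dots>" .
qed

lemma hardy_norm_sum_diff_le:
  assumes B: "\<And>k. m k \<le> B" and p: "0 < p" "p < 1"
    and f: "is_martingale m f" and n: "M k \<le> n" "n \<le> M (Suc k)"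
  shows "hardy_norm m p (sum_diff m n f) \<le>
    ennreal ((real B / (1 - 2 powr (p - 1)) + 1) powr (1 / p) *
        real (M (high_idx m n)) powr (1 / p - 1) / real (M (low_idx m n)) powr (1 / p - 1)) *
      modulus m p k f"
proof -
  define H where "H = high_idx m n"
  define N where "N = low_idx m n"
  define R where "R = real (M H) / real (M N)"
  define K where "K = real B / (1 - 2 powr (p - 1))"
  let ?W = "\<lambda>j x. f j x - mart_of m (mart_sum m (M k) f) j x"
  let ?h = "\<lambda>t. f (Suc k) t - f k t"
  let ?S = "\<lambda>x. LINT t|G. ?h t * kernel n x t"
  let ?V = "\<integral>\<^sup>+ x. ennreal_powr (maximal ?W x) p \<partial>G"
  have n0: "n > 0" using n(1) M_pos(1)[of k] by linarith
  have nH: "n < M (Suc H)" unfolding H_def by (rule high_idx_bounds(2)[OF n0])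
  have kH: "k \<le> H"
  proof (rule ccontr)
    assume "\<not> k \<le> H"
    then have "M (Suc H) \<le> M k" by (simp only: M_le_iff)
    with n(1) nH show False by linarith
  qed
  have R1: "1 \<le> R" using low_idx_digit(3)[OF n0] by (simp add: R_def H_def N_def)
  have "(2::real) powr (p - 1) < 1" using p powr_less_mono[of "p - 1" 0 2] by simp
  then have K0: "0 \<le> K" by (simp add: K_def)
  note cf = martingale_cell_const[OF f]
  have ch: "cell_const (Suc H) ?h"
    by (rule cell_const_comp2[OF cell_const_mono[OF cf] cell_const_mono[OF cf]]) (use kH in auto)
  have measW [measurable]: "?W j \<in> borel_measurable G" for j
    by (rule measurable_modulus_process[OF f])
  have [measurable]: "maximal ?W \<in> borel_measurable G"
    unfolding maximal_def[abs_def] by measurable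
  have [measurable]: "?S \<in> borel_measurable G"
  proof (subst measurable_cong[OF mart_sum_diff[OF f n, symmetric]])
    have [measurable]: "mart_sum m n f \<in> borel_measurable G" "f k \<in> borel_measurable G"
      by (rule cell_const_measurable[OF cell_const_mart_sum[OF n(2)]], rule cell_const_measurable[OF cf])
    show "(\<lambda>x. mart_sum m n f x - f k x) \<in> borel_measurable G" by measurable
  qed
  have "(\<integral>\<^sup>+ x. ennreal_powr (maximal (sum_diff m n f) x) p \<partial>G) \<le>
      (\<integral>\<^sup>+ x. ennreal_powr (ennreal (norm (?S x))) p + ennreal_powr (maximal ?W x) p \<partial>G)"
  proof (rule nn_integral_mono)
    fix x assume "x \<in> space G"
    from ennreal_powr_mono[OF maximal_sum_diff_le[OF f n this], of p]
    show "ennreal_powr (maximal (sum_diff m n f) x) p \<le>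
        ennreal_powr (ennreal (norm (?S x))) p + ennreal_powr (maximal ?W x) p"
      using p by (intro order_trans[OF _ ennreal_powr_add_le]) auto
  qed
  also have "\<dots> = (\<integral>\<^sup>+ x. ennreal_powr (ennreal (norm (?S x))) p \<partial>G) + ?V"
    by (rule nn_integral_add) measurable
  also have "(\<integral>\<^sup>+ x. ennreal_powr (ennreal (norm (?S x))) p \<partial>G) \<le>
      ennreal (K * R powr (1 - p)) * (\<integral>\<^sup>+ t. ennreal (norm (?h t) powr p) \<partial>G)"
  proof (rule order_trans[OF kernel_integral_powr_le[OF ch nH]])
    show "ennreal (real (M (Suc H)) powr (1 - p) *
        (\<Sum>j | j < Suc H \<and> digit m n j \<noteq> 0. real (M (Suc j)) powr p / real (M j))) *
        (\<integral>\<^sup>+ t. ennreal (norm (?h t) powr p) \<partial>G) \<le>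
      ennreal (K * R powr (1 - p)) * (\<integral>\<^sup>+ t. ennreal (norm (?h t) powr p) \<partial>G)"
      using digit_sum_le[OF B p n0] unfolding H_def N_def R_def K_def
      by (intro mult_right_mono ennreal_leI) auto
  qed (use p in auto)
  also have "(\<integral>\<^sup>+ t. ennreal (norm (?h t) powr p) \<partial>G) \<le> ?V"
  proof (rule nn_integral_mono)
    fix t assume t: "t \<in> space G"
    have "ennreal (norm (?h t)) = ennreal (norm (?W (Suc k) t))"
      using modulus_process[OF f t, of "Suc k" k] by simp
    also have "\<dots> \<le> maximal ?W t" unfolding maximal_def by (rule SUP_upper) simp
    finally have "ennreal_powr (ennreal (norm (?h t))) p \<le> ennreal_powr (maximal ?W t) p"
      using p by (intro ennreal_powr_mono) auto
    then show "ennreal (norm (?h t) powr p) \<le> ennreal_powr (maximal ?W t) p"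
      by (simp add: ennreal_powr_ennreal)
  qed
  also have "ennreal (K * R powr (1 - p)) * ?V + ?V = (ennreal (K * R powr (1 - p)) + 1) * ?V"
    by (simp add: distrib_right)
  also have "ennreal (K * R powr (1 - p)) + 1 \<le> ennreal ((K + 1) * R powr (1 - p))"
  proof -
    have "1 \<le> R powr (1 - p)" using R1 p by (intro ge_one_powr_ge_zero) auto
    then have "ennreal (K * R powr (1 - p) + 1) \<le> ennreal ((K + 1) * R powr (1 - p))"
      by (intro ennreal_leI) (simp add: distrib_right)
    then show ?thesis using K0 by (simp add: ennreal_plus)
  qed
  finally have main: "(\<integral>\<^sup>+ x. ennreal_powr (maximal (sum_diff m n f) x) p \<partial>G) \<le>
      ennreal ((K + 1) * R powr (1 - p)) * ?V"
    by (simp add: add_mono mult_left_mono mult_right_mono)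
  have "hardy_norm m p (sum_diff m n f) \<le> ennreal_powr (ennreal ((K + 1) * R powr (1 - p)) * ?V) (1 / p)"
    unfolding hardy_norm_def using p by (intro ennreal_powr_mono[OF main]) simp
  also have "\<dots> = ennreal (((K + 1) * R powr (1 - p)) powr (1 / p)) * modulus m p k f"
    unfolding modulus_def hardy_norm_def using K0 R1 by (intro ennreal_powr_mult) auto
  also have "((K + 1) * R powr (1 - p)) powr (1 / p) =
      (K + 1) powr (1 / p) * real (M H) powr (1 / p - 1) / real (M N) powr (1 / p - 1)"
  proof -
    have "(1 - p) * (1 / p) = 1 / p - 1" using p by (simp add: field_simps)
    then have "((K + 1) * R powr (1 - p)) powr (1 / p) = (K + 1) powr (1 / p) * R powr (1 / p - 1)"
      using K0 by (simp only: powr_mult powr_powr)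
    then show ?thesis by (simp add: R_def powr_divide)
  qed
  finally show ?thesis by (simp only: H_def N_def K_def)
qed

lemma hardy_norm_sum_diff_tendsto_0:
  assumes B: "\<And>k. m k \<le> B" and p: "0 < p" "p < 1" and f: "is_martingale m f"
    and n: "\<And>k. n k > 0"
    and small: "ennreal_smallo (\<lambda>k. modulus m p (high_idx m (n k)) f)
      (\<lambda>k. real (M (low_idx m (n k))) powr (1 / p - 1) / real (M (high_idx m (n k))) powr (1 / p - 1))"
  shows "(\<lambda>k. hardy_norm m p (sum_diff m (n k) f)) \<longlonglongrightarrow> 0"
proof (rule tendsto_zero_ennreal)
  fix e :: real assume e: "0 < e"
  define c where "c = (real B / (1 - 2 powr (p - 1)) + 1) powr (1 / p)"
  have "(2::real) powr (p - 1) < 1" using p powr_less_mono[of "p - 1" 0 2] by simp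
  then have "0 < real B / (1 - 2 powr (p - 1)) + 1" by (intro add_nonneg_pos) auto
  then have c: "0 < c" by (simp add: c_def)
  let ?l = "\<lambda>k. real (M (low_idx m (n k))) powr (1 / p - 1)"
  let ?h = "\<lambda>k. real (M (high_idx m (n k))) powr (1 / p - 1)"
  have "\<forall>\<^sub>F k in sequentially. modulus m p (high_idx m (n k)) f \<le> ennreal (e / (2 * c) * (?l k / ?h k))"
    using small[unfolded ennreal_smallo_def, rule_format, of "e / (2 * c)"] e c by simp
  then show "\<forall>\<^sub>F k in sequentially. hardy_norm m p (sum_diff m (n k) f) < ennreal e"
  proof eventually_elim
    case (elim k)
    have "hardy_norm m p (sum_diff m (n k) f) \<le>
        ennreal (c * ?h k / ?l k) * modulus m p (high_idx m (n k)) f"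
      unfolding c_def
      by (rule hardy_norm_sum_diff_le[OF B p f high_idx_bounds(1)[OF n]
            less_imp_le[OF high_idx_bounds(2)[OF n]]])
    also have "\<dots> \<le> ennreal (c * ?h k / ?l k) * ennreal (e / (2 * c) * (?l k / ?h k))"
      by (rule mult_left_mono[OF elim]) simp
    also have "\<dots> = ennreal (e / 2)"
      using c e by (simp flip: ennreal_mult)
    also have "\<dots> < ennreal e" using e by (simp add: ennreal_less_iff)
    finally show ?case .
  qed
qed

end

section \<open>A lower bound for the Dirichlet kernel\<close>

text \<open>The sum is a quotient of two chords of the unit circle joining \<open>1\<close> to a root of unity, and the
  chord in the denominator, which ends at a neighbour of \<open>1\<close>, is a shortest one.\<close>

lemma norm_geometric_sum_root_of_unity_ge:
  fixes q a :: nat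
  assumes "1 \<le> a" "a < q"
  shows "1 \<le> norm (\<Sum>b<a. cis (2 * pi / q) ^ b)"
proof -
  define y where "y = pi / q"
  have q: "q \<ge> 2" using assms by simp
  have y: "0 < y" "y \<le> pi / 2" using q by (auto simp: y_def field_simps)
  have dist: "norm (cis t - 1) = 2 * \<bar>sin (t / 2)\<bar>" for t
    using dist_exp_i_1[of t] by (simp add: cis_conv_exp)
  have siny: "0 < sin y" using y pi_gt_zero by (intro sin_gt_zero) linarith+
  have "sin y \<le> sin (a * y)"
  proof (cases "a * y \<le> pi / 2")
    case True
    have "1 * y \<le> a * y" using assms y by (intro mult_right_mono) auto
    then show ?thesis using True y by (intro sin_monotone_2pi_le) auto
  next
    case False
    have "(a + 1) * y \<le> q * y" using assms y by (intro mult_right_mono) auto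
    also have "q * y = pi" using q by (simp add: y_def)
    finally have "y \<le> pi - a * y" by (simp add: algebra_simps)
    then have "sin y \<le> sin (pi - a * y)" using False y by (intro sin_monotone_2pi_le) auto
    then show ?thesis by simp
  qed
  then have le: "norm (cis (2 * y) - 1) \<le> norm (cis (2 * (a * y)) - 1)"
    using siny by (simp add: dist)
  have ne: "cis (2 * y) \<noteq> 1"
    using dist[of "2 * y"] siny by auto
  have "cis (2 * pi / q) = cis (2 * y)" by (simp add: y_def)
  then have "(\<Sum>b<a. cis (2 * pi / q) ^ b) = (cis (2 * y) ^ a - 1) / (cis (2 * y) - 1)"
    using ne by (simp add: geometric_sum)
  also have "cis (2 * y) ^ a = cis (2 * (a * y))"
    by (simp only: Complex.DeMoivre) (simp add: mult_ac)
  finally show ?thesis using le ne by (simp add: norm_divide pos_le_divide_eq)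
qed

context vilenkin_group
begin

text \<open>If \<open>x\<close> and \<open>t\<close> lie in different cells of level \<open>l\<close>, then the digits of \<open>n\<close> from the place \<open>l\<close> on
  do not influence the modulus of the kernel.\<close>

lemma kernel_mod:
  assumes x: "x \<in> space G" "t \<in> space G" and ne: "\<not> agree l x t"
  shows "n < M (l + i) \<Longrightarrow> norm (kernel n x t) = norm (kernel (n mod M l) x t)"
proof (induction i arbitrary: n)
  case (Suc i)
  define a where "a = n div M (l + i)"
  define s where "s = n mod M (l + i)"
  have n: "n = a * M (l + i) + s" unfolding a_def s_def by (rule div_mult_mod_eq[symmetric])
  have s: "s < M (l + i)" by (simp add: s_def)
  have a: "a < m (l + i)" using Suc.prems by (simp add: a_def less_mult_imp_div_less)
  have "\<not> agree (l + i) x t" using ne agree_mono[of "l + i" x t l] by auto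
  then have "kernel (a * M (l + i)) x t = 0"
    using a by (simp add: kernel_multiple kernel_M[OF x])
  then have "norm (kernel n x t) = norm (kernel s x t)"
    using s by (simp add: n kernel_add_high[OF a] norm_mult norm_power)
  also have "\<dots> = norm (kernel (s mod M l) x t)" by (rule Suc.IH[OF s])
  also have "s mod M l = n mod M l"
    unfolding s_def by (rule mod_mod_cancel[OF M_dvd]) simp
  finally show ?case .
qed simp

lemma norm_kernel_ge:
  assumes n: "n > 0" and x: "x \<in> space G" "agree (low_idx m n) x (\<lambda>_. 0)" "x (low_idx m n) = 1"
  shows "real (M (low_idx m n)) \<le> norm (kernel n x (\<lambda>_. 0))"
proof -
  let ?o = "\<lambda>_::nat. 0::nat"
  define l where "l = low_idx m n"
  define a where "a = digit m n l"
  have a: "1 \<le> a" "a < m l"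
    using low_idx_digit(1)[OF n] digit_less[of n l] by (auto simp: a_def l_def)
  have "n mod M l = 0"
    using low_idx_digit(2)[OF n] by (force simp: digit_expansion_mod l_def)
  then have "n mod M (Suc l) = a * M l"
    using mod_mult2_eq[of n "M l" "m l"] by (simp add: a_def digit_def mult.commute)
  moreover have "\<not> agree (Suc l) x ?o" using x(3) by (simp add: agree_Suc l_def)
  moreover have "n < M (Suc l + n)" using less_M[of "Suc l + n"] by linarith
  ultimately have "norm (kernel n x ?o) = norm (kernel (a * M l) x ?o)"
    using kernel_mod[OF x(1) zero_in_space, of "Suc l" n n] by simp
  also have "kernel (a * M l) x ?o = (\<Sum>b<a. ratio l x ?o ^ b) * of_nat (M l)"
    using a x(2) by (simp add: kernel_multiple kernel_M[OF x(1)] l_def)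
  also have "ratio l x ?o = cis (2 * pi / m l)"
    using x(3) by (simp add: ratio_def rademacher_cis l_def)
  finally have "norm (kernel n x ?o) = norm (\<Sum>b<a. cis (2 * pi / m l) ^ b) * real (M l)"
    by (simp add: norm_mult)
  moreover have "1 * real (M l) \<le> norm (\<Sum>b<a. cis (2 * pi / m l) ^ b) * real (M l)"
    by (rule mult_right_mono[OF norm_geometric_sum_root_of_unity_ge[OF a]]) simp
  ultimately show ?thesis by (simp add: l_def)
qed

section \<open>Lacunary martingales\<close>

text \<open>The density of the cell of level \<open>j\<close> at the origin; it is the Dirichlet kernel of order
  \<open>M j\<close>.\<close>

definition delta :: "nat \<Rightarrow> (nat \<Rightarrow> nat) \<Rightarrow> real" where
  "delta j x = real (M j) * indicator (cyl m j (\<lambda>_. 0)) x"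

lemma cell_const_delta: "j \<le> n \<Longrightarrow> cell_const n (delta j)"
  unfolding delta_def
  by (rule cell_const_comp[OF cell_const_mono[OF cell_const_indicator]])

lemma delta_eq_kernel:
  assumes "x \<in> space G"
  shows "complex_of_real (delta j x) = kernel (M j) x (\<lambda>_. 0)"
  using assms agree_sym[of j x "\<lambda>_. 0"] agree_sym[of j "\<lambda>_. 0" x]
  by (auto simp: kernel_M delta_def cyl_eq indicator_def)

lemma integral_delta_mult_kernel:
  assumes "x \<in> space G"
  shows "(LINT t|G. of_real (delta j t) * kernel n x t) = kernel (min n (M j)) x (\<lambda>_. 0)"
proof -
  have psi0: "\<psi> i (\<lambda>_. 0) = 1" for i
    by (simp add: psi_def rademacher_def)
  have int: "integrable G (\<lambda>t. complex_of_real (delta j t))"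
    by (rule integrable_cell_const[OF cell_const_comp[OF cell_const_delta[OF order_refl]]])
  have "fun_coeff m (\<lambda>t. of_real (delta j t)) i = (if i < M j then 1 else 0)" for i
  proof -
    have "fun_coeff m (\<lambda>t. of_real (delta j t)) i = fun_coeff m (\<lambda>t. \<Sum>i<M j. 1 * \<psi> i t) i"
      by (rule fun_coeff_cong) (simp add: delta_eq_kernel kernel_def psi0)
    then show ?thesis by (simp only: fun_coeff_sum_psi)
  qed
  then have "(LINT t|G. of_real (delta j t) * kernel n x t) = (\<Sum>i<n. if i < M j then \<psi> i x else 0)"
    unfolding fun_sum_kernel[OF int, symmetric] fun_sum_def by (intro sum.cong) auto
  also have "\<dots> = (\<Sum>i | i \<in> {..<n} \<and> i < M j. \<psi> i x)"
    by (rule sum.inter_filter[symmetric]) simp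
  also have "{i. i \<in> {..<n} \<and> i < M j} = {..<min n (M j)}" by auto
  finally show ?thesis by (simp add: kernel_def psi0)
qed

lemma integral_indicator_delta:
  assumes S: "S \<in> sets (vfilt m n)" and "n \<le> j"
  shows "(LINT x|G. indicator S x * delta j x) = indicator S (\<lambda>_. 0)"
proof -
  let ?o = "\<lambda>_::nat. 0::nat"
  have cS: "cell_const n (\<lambda>x. x \<in> S)" using S by (simp add: sets_vfilt)
  have "(LINT x|G. indicator S x * delta j x) =
      (LINT x|G. (indicator S ?o * real (M j)) * indicator (cyl m j ?o) x)"
  proof (intro Bochner_Integration.integral_cong refl)
    fix x
    show "indicator S x * delta j x = indicator S ?o * real (M j) * indicator (cyl m j ?o) x"
      using cell_constD[OF cS zero_in_space, of x] agree_mono[OF _ assms(2), of ?o x]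
      by (cases "x \<in> cyl m j ?o") (auto simp: delta_def cyl_eq indicator_def)
  qed
  also have "\<dots> = indicator S ?o"
    by (simp add: measure_cyl)
  finally show ?thesis .
qed

lemma norm_delta_diff_le:
  "\<bar>delta (Suc j) x - delta j x\<bar> \<le> real (M (Suc j)) * indicator (cyl m j (\<lambda>_. 0)) x"
proof -
  have "real (M j) \<le> real (M (Suc j))" by (simp only: of_nat_le_iff M_le_iff)
  then show ?thesis
    by (auto simp: delta_def cyl_eq indicator_def agree_Suc simp del: gen_pow.simps)
qed

text \<open>The martingale \<open>\<Sum>\<^sub>i w\<^sub>i (D\<^bsub>M (A i + 1)\<^esub> - D\<^bsub>M (A i)\<^esub>)\<close>, whose Fourier coefficients are \<open>w\<^sub>i\<close> on
  the block from \<open>M (A i)\<close> to \<open>M (A i + 1)\<close> and zero outside these blocks.\<close>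

definition lacunary :: "(nat \<Rightarrow> nat) \<Rightarrow> (nat \<Rightarrow> real) \<Rightarrow> process" where
  "lacunary A w n x = of_real (\<Sum>i | A i < n. w i * (delta (Suc (A i)) x - delta (A i) x))"

lemma finite_strict_mono_less:
  fixes A :: "nat \<Rightarrow> nat"
  assumes "strict_mono A"
  shows "finite {i. A i < n}"
proof (rule finite_subset)
  show "{i. A i < n} \<subseteq> {..<n}"
    using strict_mono_imp_increasing[OF assms] le_less_trans by auto
qed simp

context
  fixes A :: "nat \<Rightarrow> nat" and w :: "nat \<Rightarrow> real"
  assumes A: "strict_mono A" and w: "\<And>i. 0 \<le> w i"
begin

lemma cell_const_lacunary: "cell_const n (lacunary A w n)"
  unfolding lacunary_def
  by (rule cell_const_comp[OF cell_const_sum],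
      rule cell_const_comp[OF cell_const_comp2[OF cell_const_delta cell_const_delta]]) auto

lemma is_martingale_lacunary: "is_martingale m (lacunary A w)"
  unfolding is_martingale_def
proof (intro conjI allI impI)
  show "lacunary A w n \<in> borel_measurable (vfilt m n)" for n
    by (simp add: measurable_vfilt_iff cell_const_lacunary)
  show "integrable G (lacunary A w n)" for n
    by (rule integrable_cell_const[OF cell_const_lacunary])
  fix n k :: nat assume "n \<le> k"
  interpret sub: finite_measure_subalgebra G "vfilt m n"
    by (rule finite_measure_subalgebra_vfilt)
  let ?g = "\<lambda>n x. \<Sum>i | A i < n. w i * (delta (Suc (A i)) x - delta (A i) x)"
  have cg: "cell_const n (?g n)" for n
    by (rule cell_const_sum,
        rule cell_const_comp[OF cell_const_comp2[OF cell_const_delta cell_const_delta]]) auto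
  have int: "integrable G (\<lambda>x. indicator S x * delta j x)" if "S \<in> sets (vfilt m n)" for S j
    using integrable_cell_const[OF cell_const_delta[OF order_refl[of j]]] that subalgebra_vfilt[of n]
    by (intro integrable_real_mult_indicator[of _ _ "delta j", simplified mult.commute])
      (auto simp: subalgebra_def)
  have "AE x in G. real_cond_exp G (vfilt m n) (?g k) x = ?g n x"
  proof (rule sub.real_cond_exp_charact)
    fix S assume S: "S \<in> sets (vfilt m n)"
    have eq: "(\<integral>x\<in>S. ?g k x \<partial>G) =
        (\<Sum>i | A i < k. w i * ((LINT x|G. indicator S x * delta (Suc (A i)) x) -
          (LINT x|G. indicator S x * delta (A i) x)))" for k
    proof -
      have "(\<integral>x\<in>S. ?g k x \<partial>G) = (LINT x|G. (\<Sum>i | A i < k.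
          w i * (indicator S x * delta (Suc (A i)) x - indicator S x * delta (A i) x)))"
        unfolding set_lebesgue_integral_def
        by (intro Bochner_Integration.integral_cong refl)
          (simp add: sum_distrib_left right_diff_distrib mult_ac)
      also have "\<dots> = (\<Sum>i | A i < k. (LINT x|G.
          w i * (indicator S x * delta (Suc (A i)) x - indicator S x * delta (A i) x)))"
        by (intro Bochner_Integration.integral_sum integrable_mult_right
            Bochner_Integration.integrable_diff int S)
      finally show ?thesis by (simp add: int[OF S])
    qed
    show "(\<integral>x\<in>S. ?g k x \<partial>G) = (\<integral>x\<in>S. ?g n x \<partial>G)"
      unfolding eq using \<open>n \<le> k\<close> finite_strict_mono_less[OF A]
      by (intro sum.mono_neutral_right) (auto simp: integral_indicator_delta[OF S] not_less)
  next
    show "integrable G (?g k)" "integrable G (?g n)"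
      by (rule integrable_cell_const[OF cg])+
    show "?g n \<in> borel_measurable (vfilt m n)"
      using cg[of n] by (simp add: measurable_vfilt_iff)
  qed
  moreover have "AE x in G. real_cond_exp G (vfilt m n) (\<lambda>_. 0) x = 0"
    by (rule sub.real_cond_exp_F_meas) auto
  ultimately show "AE x in G. complex_cond_exp G (vfilt m n) (lacunary A w k) x = lacunary A w n x"
    by eventually_elim (simp add: complex_cond_exp_def lacunary_def complex_eq_iff)
qed

lemma lacunary_Suc_diff:
  "lacunary A w (Suc (A k)) x - lacunary A w (A k) x =
    of_real (w k) * (of_real (delta (Suc (A k)) x) - of_real (delta (A k) x))"
proof -
  have "{i. A i < Suc (A k)} = insert k {i. A i < A k}"
    using strict_mono_eq[OF A] by (auto simp: less_Suc_eq)
  then show ?thesis by (simp add: lacunary_def finite_strict_mono_less[OF A])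
qed

lemma mart_sum_lacunary:
  assumes n: "M (A k) \<le> n" "n \<le> M (Suc (A k))" and x: "x \<in> space G"
  shows "mart_sum m n (lacunary A w) x = lacunary A w (A k) x +
    of_real (w k) * (kernel n x (\<lambda>_. 0) - kernel (M (A k)) x (\<lambda>_. 0))"
proof -
  have int: "integrable G (\<lambda>t. complex_of_real (delta j t) * kernel n x t)" for j
  proof -
    have "cell_const (max j n) (\<lambda>t. complex_of_real (delta j t) * kernel n x t)"
      by (rule cell_const_comp2[OF cell_const_comp[OF cell_const_delta] cell_const_kernel])
        (use less_M[of "max j n"] in auto)
    then show ?thesis by (rule integrable_cell_const)
  qed
  have "mart_sum m n (lacunary A w) x - lacunary A w (A k) x =
      (LINT t|G. of_real (w k) * (of_real (delta (Suc (A k)) t) * kernel n x t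
        - of_real (delta (A k) t) * kernel n x t))"
    unfolding mart_sum_diff[OF is_martingale_lacunary n x] lacunary_Suc_diff
    by (simp add: algebra_simps)
  also have "\<dots> = of_real (w k) * (kernel n x (\<lambda>_. 0) - kernel (M (A k)) x (\<lambda>_. 0))"
    using n by (simp add: int integral_delta_mult_kernel[OF x] min_absorb1 min_absorb2 del: gen_pow.simps)
  finally show ?thesis by (simp add: algebra_simps)
qed

text \<open>Away from the cell of level \<open>A k\<close> at the origin, the martingale is constant from the index \<open>A k\<close> on.\<close>

lemma mart_lim_lacunary:
  assumes "\<not> agree (A k) (\<lambda>_. 0) x"
  shows "mart_lim (lacunary A w) x = lacunary A w (A k) x"
  unfolding mart_lim_def
proof (rule limI, rule tendsto_eventually, rule eventually_sequentiallyI)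
  fix n assume "A k \<le> n"
  have "delta j x = 0" if "A k \<le> j" for j
    using assms agree_mono[of j "\<lambda>_. 0" x "A k"] that by (auto simp: delta_def cyl_eq indicator_def)
  then show "lacunary A w n x = lacunary A w (A k) x"
    unfolding lacunary_def using \<open>A k \<le> n\<close>
    by (intro arg_cong[where f = of_real] sum.mono_neutral_right finite_strict_mono_less[OF A]) (auto simp: not_less)
qed

text \<open>On the cell of level \<open>N + 1\<close> around \<open>?e\<close>, where \<open>N = low_idx m n\<close>, the difference \<open>S\<^sub>n f - f\<close> is
  a multiple of the Dirichlet kernel. A level strictly below its lower bound \<open>L\<close> is needed in the
  weak quasi-norm, whence \<open>L / 2\<close>.\<close>

lemma weak_norm_lacunary_ge:
  assumes B: "\<And>k. m k \<le> B" and p: "0 < p" and n: "n > 0"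
    and idx: "high_idx m n = A k" "low_idx m n < A k"
    and wk: "w k = real (M (low_idx m n)) powr (1 / p - 1)"
  shows "ennreal (1 / 2 * (1 / real B) powr (1 / p)) \<le>
    weak_norm m p (\<lambda>x. mart_sum m n (lacunary A w) x - mart_lim (lacunary A w) x)"
proof -
  define N where "N = low_idx m n"
  let ?o = "\<lambda>_::nat. 0::nat"
  let ?e = "\<lambda>j. if j = N then 1 else 0 :: nat"
  let ?g = "\<lambda>x. mart_sum m n (lacunary A w) x - mart_lim (lacunary A w) x"
  define L where "L = real (M N) powr (1 / p)"
  have L: "0 < L" by (simp add: L_def)
  have e: "?e \<in> space G"
    using two_le_m[of N] by (auto simp: space_G)
  have big: "L \<le> norm (?g x)" if "x \<in> cyl m (Suc N) ?e" for x
  proof -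
    have x: "x \<in> space G" "agree N x ?o" "x N = 1"
      using that by (auto simp: cyl_eq agree_Suc) (auto simp: agree_def)
    have ne: "\<not> agree (A k) x ?o" "\<not> agree (A k) ?o x"
      using x(3) idx(2) by (auto simp: agree_def N_def)
    have "?g x = of_real (w k) * kernel n x ?o"
      using high_idx_bounds[OF n] ne kernel_M[OF x(1) zero_in_space, of "A k"]
      by (simp add: mart_sum_lacunary[OF _ _ x(1), of k] mart_lim_lacunary[OF ne(2)] idx(1) del: gen_pow.simps)
    then have "norm (?g x) = w k * norm (kernel n x ?o)"
      using w[of k] by (simp add: norm_mult)
    also have "\<dots> \<ge> w k * real (M N)"
      using norm_kernel_ge[OF n x(1)] x w[of k] by (intro mult_left_mono) (auto simp: N_def)
    also have "w k * real (M N) = L"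
      by (simp add: wk L_def N_def powr_diff)
    finally show ?thesis .
  qed
  have [measurable]: "lacunary A w j \<in> borel_measurable G" for j
    by (rule cell_const_measurable[OF cell_const_lacunary])
  have "n \<le> M n" using less_M[of n] by simp
  then have [measurable]: "mart_sum m n (lacunary A w) \<in> borel_measurable G"
    by (rule cell_const_measurable[OF cell_const_mart_sum])
  have [measurable]: "mart_lim (lacunary A w) \<in> borel_measurable G"
    unfolding mart_lim_def[abs_def] by (rule borel_measurable_lim_metric) measurable
  have "1 / real B * (1 / real (M N)) \<le> 1 / real (m N) * (1 / real (M N))"
  proof (intro mult_right_mono divide_left_mono)
    show "0 < real B * real (m N)" using less_le_trans[OF m_pos(1) B] by simp
  qed (use B[of N] in auto)
  also have "\<dots> = 1 / real (M (Suc N))" by simp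
  also have "\<dots> = measure G (cyl m (Suc N) ?e)"
    by (rule measure_cyl[OF e, symmetric])
  also have "\<dots> \<le> measure G {x \<in> space G. norm (?g x) > L / 2}"
  proof (rule finite_measure_mono)
    show "cyl m (Suc N) ?e \<subseteq> {x \<in> space G. norm (?g x) > L / 2}"
      using big L by (force simp: cyl_eq)
  qed measurable
  finally have meas: "1 / real B * (1 / real (M N)) \<le> measure G {x \<in> space G. norm (?g x) > L / 2}" .
  have "1 / 2 * (1 / real B) powr (1 / p) = L / 2 * (1 / real B * (1 / real (M N))) powr (1 / p)"
    by (simp add: L_def powr_mult powr_divide)
  also have "\<dots> \<le> L / 2 * measure G {x \<in> space G. norm (?g x) > L / 2} powr (1 / p)"
    using p L by (intro mult_left_mono powr_mono2 meas) auto
  finally have "ennreal (1 / 2 * (1 / real B) powr (1 / p)) \<le>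
      ennreal (L / 2 * measure G {x \<in> space G. norm (?g x) > L / 2} powr (1 / p))"
    by (rule ennreal_leI)
  also have "\<dots> \<le> weak_norm m p ?g"
    unfolding weak_norm_def using L by (intro SUP_upper) simp
  finally show ?thesis .
qed

lemma norm_lacunary_diff_le:
  "norm (lacunary A w n x - lacunary A w (min (A k) n) x) \<le>
    (\<Sum>i | k \<le> i \<and> A i < n. w i * real (M (Suc (A i))) * indicator (cyl m (A i) (\<lambda>_. 0)) x)"
proof -
  let ?t = "\<lambda>i. w i * (delta (Suc (A i)) x - delta (A i) x)"
  note fin = finite_strict_mono_less[OF A]
  have split: "(\<Sum>i | A i < n. ?t i) = (\<Sum>i | A i < min (A k) n. ?t i) + (\<Sum>i | k \<le> i \<and> A i < n. ?t i)"
  proof -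
    let ?I = "{i. A i < min (A k) n}" and ?J = "{i. k \<le> i \<and> A i < n}"
    have "{i. A i < n} = ?I \<union> ?J" "?I \<inter> ?J = {}"
      by (auto simp: strict_mono_less[OF A])
    moreover have "finite ?J"
      by (rule finite_subset[OF _ fin[of n]]) blast
    ultimately show ?thesis
      using sum.union_disjoint[OF fin[of "min (A k) n"], of ?J ?t] by (simp only:)
  qed
  have "lacunary A w n x - lacunary A w (min (A k) n) x = of_real (\<Sum>i | k \<le> i \<and> A i < n. ?t i)"
    unfolding lacunary_def split of_real_add by (rule add_diff_cancel_left')
  then have "norm (lacunary A w n x - lacunary A w (min (A k) n) x) = \<bar>\<Sum>i | k \<le> i \<and> A i < n. ?t i\<bar>"
    by (simp only: norm_of_real)
  also have "\<dots> \<le> (\<Sum>i | k \<le> i \<and> A i < n. \<bar>?t i\<bar>)" by (rule sum_abs)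
  also have "\<dots> \<le> (\<Sum>i | k \<le> i \<and> A i < n. w i * real (M (Suc (A i))) * indicator (cyl m (A i) (\<lambda>_. 0)) x)"
    unfolding abs_mult mult.assoc using w norm_delta_diff_le by (intro sum_mono mult_mono) auto
  finally show ?thesis .
qed

text \<open>If \<open>q\<^sub>i\<close> bounds \<open>w\<^sub>i\<^sup>p M(A i)\<^bsup>p-1\<^esup>\<close>, which is up to a constant the \<open>p\<close>-th power of the Hardy
  quasi-norm of the \<open>i\<close>-th term, and decreases geometrically, then a tail is controlled by the bound
  for its first term. The process \<open>g\<close> is kept general, because the tails arise in different forms.\<close>

lemma nn_integral_maximal_lacunary_le:
  assumes B: "\<And>k. m k \<le> B" and p: "0 < p" "p \<le> 1"
    and \<theta>: "0 < \<theta>" "\<theta> < 1"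
    and q: "\<And>i. w i powr p * real (M (A i)) powr (p - 1) \<le> q i" "\<And>i. q (Suc i) \<le> \<theta> * q i"
    and g: "\<And>n x. x \<in> space G \<Longrightarrow> norm (g n x) \<le>
      (\<Sum>i | k \<le> i \<and> A i < n. w i * real (M (Suc (A i))) * indicator (cyl m (A i) (\<lambda>_. 0)) x)"
  shows "(\<integral>\<^sup>+ x. ennreal_powr (maximal g x) p \<partial>G) \<le> ennreal (real B powr p / (1 - \<theta>) * q k)"
proof -
  let ?o = "\<lambda>_::nat. 0::nat"
  let ?c = "\<lambda>i. (w i * real (M (Suc (A i)))) powr p"
  have qk: "q (k + j) \<le> \<theta> ^ j * q k" for j
  proof (induction j)
    case (Suc j)
    have "q (k + Suc j) \<le> \<theta> * q (k + j)" using q(2)[of "k + j"] by simp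
    also have "\<dots> \<le> \<theta> * (\<theta> ^ j * q k)" using Suc \<theta> by (intro mult_left_mono) auto
    finally show ?case by (simp add: mult_ac)
  qed simp
  have q0: "0 \<le> q k" by (rule order_trans[OF _ q(1)]) simp
  have c: "?c (k + j) / real (M (A (k + j))) \<le> real B powr p * q k * \<theta> ^ j" for j
  proof -
    let ?i = "k + j"
    have "real (M (Suc (A ?i))) \<le> real B * real (M (A ?i))"
      using B[of "A ?i"] by (simp add: mult_right_mono)
    then have "?c ?i \<le> (w ?i * (real B * real (M (A ?i)))) powr p"
      using p w by (intro powr_mono2 mult_left_mono) (auto simp del: gen_pow.simps)
    then have "?c ?i / real (M (A ?i)) \<le> (w ?i * (real B * real (M (A ?i)))) powr p / real (M (A ?i))"
      by (rule divide_right_mono) simp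
    also have "\<dots> = real B powr p * (w ?i powr p * real (M (A ?i)) powr (p - 1))"
      by (simp add: powr_mult powr_diff)
    also have "\<dots> \<le> real B powr p * (\<theta> ^ j * q k)"
      using order_trans[OF q(1) qk] by (intro mult_left_mono) auto
    finally show ?thesis by (simp add: mult_ac)
  qed
  have "(\<integral>\<^sup>+ x. ennreal_powr (maximal g x) p \<partial>G) \<le>
      (\<integral>\<^sup>+ x. (\<Sum>j. ennreal (?c (k + j)) * indicator (cyl m (A (k + j)) ?o) x) \<partial>G)"
  proof (rule nn_integral_mono)
    fix x assume x: "x \<in> space G"
    let ?u = "\<lambda>i. w i * real (M (Suc (A i))) * indicator (cyl m (A i) ?o) x"
    show "ennreal_powr (maximal g x) p \<le> (\<Sum>j. ennreal (?c (k + j)) * indicator (cyl m (A (k + j)) ?o) x)"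
      unfolding maximal_def
    proof (rule ennreal_powr_SUP_le[OF p(1)])
      fix n
      let ?I = "{i. k \<le> i \<and> A i < n}"
      have fin: "finite ?I" by (rule finite_subset[OF _ finite_strict_mono_less[OF A, of n]]) auto
      have u0: "0 \<le> ?u i" for i using w[of i] by simp
      have "ennreal_powr (ennreal (norm (g n x))) p \<le> ennreal_powr (\<Sum>i\<in>?I. ennreal (?u i)) p"
        using p g[OF x, of n] u0 by (intro ennreal_powr_mono) (auto simp: sum_ennreal intro!: ennreal_leI)
      also have "\<dots> \<le> (\<Sum>i\<in>?I. ennreal_powr (ennreal (?u i)) p)"
        by (rule ennreal_powr_sum_le[OF p])
      also have "\<dots> = (\<Sum>i\<in>?I. ennreal (?c i) * indicator (cyl m (A i) ?o) x)"
        using w by (intro sum.cong refl) (auto simp: ennreal_powr_ennreal indicator_def simp del: gen_pow.simps)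
      also have "\<dots> = (\<Sum>j | k + j \<in> ?I. ennreal (?c (k + j)) * indicator (cyl m (A (k + j)) ?o) x)"
        by (rule sum.reindex_bij_witness[of _ "\<lambda>j. k + j" "\<lambda>i. i - k"]) auto
      also have "\<dots> \<le> (\<Sum>j. ennreal (?c (k + j)) * indicator (cyl m (A (k + j)) ?o) x)"
      proof (rule sum_le_suminf)
        show "finite {j. k + j \<in> ?I}"
          using finite_vimageI[OF fin, of "(+) k"] by (simp add: vimage_def)
      qed auto
      finally show "ennreal_powr (ennreal (norm (g n x))) p \<le> \<dots>" .
    qed
  qed
  also have "\<dots> = (\<Sum>j. \<integral>\<^sup>+ x. ennreal (?c (k + j)) * indicator (cyl m (A (k + j)) ?o) x \<partial>G)"
    by (rule nn_integral_suminf) measurable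
  also have "\<dots> = (\<Sum>j. ennreal (?c (k + j) / real (M (A (k + j)))))"
    by (simp add: nn_integral_cmult_indicator emeasure_cyl flip: ennreal_mult del: gen_pow.simps)
  also have "\<dots> \<le> (\<Sum>j. ennreal (real B powr p * q k * \<theta> ^ j))"
    by (intro suminf_le ennreal_leI c) auto
  also have "\<dots> = ennreal (real B powr p * q k * (1 / (1 - \<theta>)))"
    using \<theta> q0 by (intro suminf_ennreal_eq sums_mult geometric_sums) auto
  finally show ?thesis by (simp add: mult_ac)
qed

end

section \<open>Sharpness\<close>

text \<open>A subsequence along which the quotients \<open>M\<^bsub>low\<^esub> / M\<^bsub>high\<^esub>\<close> decrease at least
  geometrically.\<close>

lemma ex_lacunary_subsequence:
  fixes n :: "nat \<Rightarrow> nat"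
  assumes n: "strict_mono n" "\<And>k. n k > 0" and rho: "(SUP k. enat (rho m (n k))) = \<infinity>"
  obtains s where "strict_mono s" "\<And>i. low_idx m (n (s i)) < high_idx m (n (s i))"
    "strict_mono (\<lambda>i. high_idx m (n (s i)))"
    "\<And>i. 2 * real (M (low_idx m (n (s (Suc i))))) / real (M (high_idx m (n (s (Suc i)))))
      \<le> real (M (low_idx m (n (s i)))) / real (M (high_idx m (n (s i))))"
proof -
  have unbounded: "\<exists>k. b \<le> rho m (n k)" for b
  proof (rule ccontr)
    assume "\<not> (\<exists>k. b \<le> rho m (n k))"
    then have "enat (rho m (n k)) \<le> enat b" for k by (simp add: not_le less_imp_le)
    then have "(SUP k. enat (rho m (n k))) \<le> enat b" by (rule SUP_least)
    with rho show False by simp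
  qed
  \<comment> \<open>The second condition makes \<open>high_idx\<close> increase, since \<open>rho m n \<le> high_idx m n\<close>, and makes the
    quotients at least halve, since \<open>2 ^ rho m n\<close> is at most \<open>M (high_idx m n) / M (low_idx m n)\<close>.\<close>
  have "\<exists>s. \<forall>i. 1 \<le> rho m (n (s i)) \<and> 2 * n (s i) \<le> rho m (n (s (Suc i)))"
  proof (rule dependent_nat_choice)
    show "\<exists>k. 1 \<le> rho m (n k)" by (rule unbounded)
    show "\<exists>k'. 1 \<le> rho m (n k') \<and> 2 * n k \<le> rho m (n k')" for k
    proof -
      obtain k' where "2 * n k \<le> rho m (n k')" using unbounded by blast
      moreover from this have "1 \<le> rho m (n k')" using n(2)[of k] by linarith
      ultimately show ?thesis by blast
    qed
  qed
  then obtain s where s: "\<And>i. 1 \<le> rho m (n (s i))" "\<And>i. 2 * n (s i) \<le> rho m (n (s (Suc i)))"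
    by blast
  let ?H = "\<lambda>i. high_idx m (n (s i))" and ?L = "\<lambda>i. low_idx m (n (s i))"
  note H = high_idx_bounds[OF n(2)]
  have step: "2 * n (s i) \<le> ?H (Suc i)" for i
    using s(2)[of i] by (simp add: rho_def)
  show thesis
  proof
    show "strict_mono s"
    proof (rule strict_monoI_Suc)
      fix i
      have "n (s i) < n (s (Suc i))"
        using step[of i] less_M[of "?H (Suc i)"] H(1)[of "s (Suc i)"] by linarith
      then show "s i < s (Suc i)" by (simp add: strict_mono_less[OF n(1)])
    qed
    show "?L i < ?H i" for i using s(1)[of i] by (simp add: rho_def)
    show "strict_mono ?H"
    proof (rule strict_monoI_Suc)
      show "?H i < ?H (Suc i)" for i
        using step[of i] less_M[of "?H i"] H(1)[of "s i"] by linarith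
    qed
    fix i
    define d where "d = rho m (n (s (Suc i)))"
    have HL: "?H (Suc i) = ?L (Suc i) + d"
      using low_idx_digit(3)[OF n(2), of "s (Suc i)"] by (simp add: d_def rho_def)
    have "2 * M (?H i) \<le> 2 ^ d"
      using s(2)[of i] H(1)[of "s i"] less_exp[of d] unfolding d_def by linarith
    then have "2 * M (?H i) * M (?L (Suc i)) \<le> 2 ^ d * M (?L (Suc i))" by simp
    also have "\<dots> \<le> M (?H (Suc i))" unfolding HL by (rule two_power_M_le)
    also have "\<dots> \<le> M (?L i) * M (?H (Suc i))" using mult_le_mono1[of 1 "M (?L i)"] by (simp add: Suc_le_eq)
    finally have "real (2 * M (?H i) * M (?L (Suc i))) \<le> real (M (?L i) * M (?H (Suc i)))"
      by (simp only: of_nat_le_iff)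
    then have "2 * real (M (?H i)) * real (M (?L (Suc i))) \<le> real (M (?L i)) * real (M (?H (Suc i)))"
      by (simp only: of_nat_mult of_nat_numeral)
    then show "2 * real (M (?L (Suc i))) / real (M (?H (Suc i))) \<le> real (M (?L i)) / real (M (?H i))"
      by (simp add: field_simps)
  qed
qed

lemma ex_slowly_approximated_martingale:
  fixes n :: "nat \<Rightarrow> nat"
  assumes B: "\<And>k. m k \<le> B" and p: "0 < p" "p < 1"
    and n: "strict_mono n" "\<And>k. n k > 0" and rho: "(SUP k. enat (rho m (n k))) = \<infinity>"
  shows "\<exists>f\<in>hardy m p. \<exists>s :: nat \<Rightarrow> nat. strict_mono s \<and>
    ennreal_bigo (\<lambda>k. modulus m p (high_idx m (n (s k))) f)
      (\<lambda>k. real (M (low_idx m (n (s k)))) powr (1 / p - 1) / real (M (high_idx m (n (s k)))) powr (1 / p - 1)) \<and>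
    (\<exists>c>0. limsup (\<lambda>k. weak_norm m p (\<lambda>x. mart_sum m (n (s k)) f x - mart_lim f x)) > ennreal c)"
proof -
  obtain s where s: "strict_mono s" "\<And>i. low_idx m (n (s i)) < high_idx m (n (s i))"
    "strict_mono (\<lambda>i. high_idx m (n (s i)))"
    and quot: "\<And>i. 2 * real (M (low_idx m (n (s (Suc i))))) / real (M (high_idx m (n (s (Suc i)))))
      \<le> real (M (low_idx m (n (s i)))) / real (M (high_idx m (n (s i))))"
    using ex_lacunary_subsequence[OF n rho] by blast
  define A where "A i = high_idx m (n (s i))" for i
  define L where "L i = low_idx m (n (s i))" for i
  define w where "w i = real (M (L i)) powr (1 / p - 1)" for i
  define \<theta> :: real where "\<theta> = 2 powr (p - 1)"
  define q where "q i = (real (M (L i)) / real (M (A i))) powr (1 - p)" for i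
  define K where "K = real B powr p / (1 - \<theta>)"
  let ?f = "lacunary A w"
  have A: "strict_mono A" using s(3) by (simp add: A_def[abs_def])
  have w: "0 \<le> w i" for i by (simp add: w_def)
  have B0: "0 < B" using B[of 0] m_pos(1)[of 0] by linarith
  have \<theta>: "0 < \<theta>" "\<theta> < 1" using p powr_less_mono[of "p - 1" 0 2] by (auto simp: \<theta>_def)
  have K: "0 < K" using \<theta> B0 by (simp add: K_def)
  have q1: "w i powr p * real (M (A i)) powr (p - 1) \<le> q i" for i
  proof -
    have "(1 / p - 1) * p = 1 - p" using p by (simp add: field_simps)
    then show ?thesis
      using powr_minus_divide[of "real (M (A i))" "1 - p"]
      by (simp add: w_def q_def powr_powr powr_divide)
  qed
  have q2: "q (Suc i) \<le> \<theta> * q i" for i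
  proof -
    let ?x = "real (M (L (Suc i))) / real (M (A (Suc i)))" and ?y = "real (M (L i)) / real (M (A i))"
    have "?x \<le> ?y / 2" using quot[of i] by (simp add: A_def L_def)
    then have "q (Suc i) \<le> (?y / 2) powr (1 - p)"
      unfolding q_def using p by (intro powr_mono2) auto
    also have "\<dots> = q i / 2 powr (1 - p)"
      unfolding q_def by (rule powr_divide)
    also have "\<dots> = \<theta> * q i"
      using powr_minus_divide[of 2 "1 - p"] by (simp add: \<theta>_def)
    finally show ?thesis .
  qed
  have bound: "(\<integral>\<^sup>+ x. ennreal_powr (maximal g x) p \<partial>G) \<le> ennreal (K * q k)"
    if "\<And>n x. x \<in> space G \<Longrightarrow> norm (g n x) = norm (?f n x - ?f (min (A k) n) x)" for g k
    unfolding K_def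
    by (rule nn_integral_maximal_lacunary_le[OF A w B p(1) less_imp_le[OF p(2)] \<theta> q1 q2])
      (simp only: that norm_lacunary_diff_le[OF A w])
  have mart: "is_martingale m ?f" by (rule is_martingale_lacunary[OF A w])
  have f: "?f \<in> hardy m p"
  proof -
    have "?f (min (A 0) n) x = 0" for n x
    proof -
      have "{i. A i < min (A 0) n} = {}" using strict_mono_less[OF A, of _ 0] by auto
      then show ?thesis by (simp only: lacunary_def) simp
    qed
    then have "(\<integral>\<^sup>+ x. ennreal_powr (maximal ?f x) p \<partial>G) \<le> ennreal (K * q 0)"
      by (intro bound) simp
    then have "hardy_norm m p ?f \<le> ennreal_powr (ennreal (K * q 0)) (1 / p)"
      unfolding hardy_norm_def using p by (intro ennreal_powr_mono) auto
    also have "\<dots> < \<infinity>" using K by (simp add: q_def ennreal_powr_ennreal)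
    finally show ?thesis using mart by (simp add: hardy_def)
  qed
  have mod: "modulus m p (A k) ?f \<le> ennreal (K powr (1 / p) *
      (real (M (L k)) powr (1 / p - 1) / real (M (A k)) powr (1 / p - 1)))" for k
  proof -
    have "(\<integral>\<^sup>+ x. ennreal_powr (maximal (\<lambda>j x. ?f j x - mart_of m (mart_sum m (M (A k)) ?f) j x) x) p \<partial>G)
        \<le> ennreal (K * q k)"
      by (rule bound) (simp only: modulus_process[OF mart])
    then have "modulus m p (A k) ?f \<le> ennreal_powr (ennreal (K * q k)) (1 / p)"
      unfolding modulus_def hardy_norm_def using p by (intro ennreal_powr_mono) auto
    also have "\<dots> = ennreal ((K * q k) powr (1 / p))"
      using K by (intro ennreal_powr_ennreal) (simp add: q_def)
    also have "(K * q k) powr (1 / p) = K powr (1 / p) *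
        (real (M (L k)) powr (1 / p - 1) / real (M (A k)) powr (1 / p - 1))"
    proof -
      have "(1 - p) * (1 / p) = 1 / p - 1" using p by (simp add: field_simps)
      then show ?thesis using K by (simp only: q_def powr_mult powr_powr powr_divide)
    qed
    finally show ?thesis .
  qed
  define c where "c = 1 / 2 * (1 / real B) powr (1 / p)"
  have c: "0 < c" using B0 by (simp add: c_def)
  have "ennreal c \<le> weak_norm m p (\<lambda>x. mart_sum m (n (s k)) ?f x - mart_lim ?f x)" for k
    unfolding c_def
    by (rule weak_norm_lacunary_ge[OF A w B p(1) n(2)]) (use s(2) in \<open>auto simp: A_def L_def w_def\<close>)
  then have "ennreal c \<le> limsup (\<lambda>k. weak_norm m p (\<lambda>x. mart_sum m (n (s k)) ?f x - mart_lim ?f x))"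
    by (intro le_Limsup) auto
  moreover have "ennreal (c / 2) < ennreal c" using c by (simp add: ennreal_less_iff)
  ultimately have "\<exists>c>0. limsup (\<lambda>k. weak_norm m p (\<lambda>x. mart_sum m (n (s k)) ?f x - mart_lim ?f x)) > ennreal c"
    using c by (intro exI[of _ "c / 2"]) auto
  moreover have "ennreal_bigo (\<lambda>k. modulus m p (high_idx m (n (s k))) ?f)
      (\<lambda>k. real (M (low_idx m (n (s k)))) powr (1 / p - 1) / real (M (high_idx m (n (s k)))) powr (1 / p - 1))"
    unfolding ennreal_bigo_def
    using mod K unfolding A_def L_def by (intro exI[of _ "K powr (1 / p)"]) auto
  ultimately show ?thesis using f s(1) by blast
qed

end

theorem theorem2:
  fixes m :: "nat \<Rightarrow> nat" and p :: real
  assumes "\<And>k. m k \<ge> 2" and "bdd_above (range m)" and "0 < p" and "p < 1"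
  shows
    "(\<exists>c>0. \<forall>f\<in>hardy m p. \<forall>k n. gen_pow m k < n \<and> n \<le> gen_pow m (Suc k) \<longrightarrow>
        hardy_norm m p (sum_diff m n f)
          \<le> ennreal (c * real (gen_pow m (high_idx m n)) powr (1 / p - 1)
                       / real (gen_pow m (low_idx m n)) powr (1 / p - 1))
            * modulus m p k f)
     \<and>
     (\<forall>f\<in>hardy m p. \<forall>n :: nat \<Rightarrow> nat.
        strict_mono n \<and> (\<forall>k. n k > 0) \<and>
        ennreal_smallo (\<lambda>k. modulus m p (high_idx m (n k)) f)
          (\<lambda>k. real (gen_pow m (low_idx m (n k))) powr (1 / p - 1)
                / real (gen_pow m (high_idx m (n k))) powr (1 / p - 1))
        \<longrightarrow> (\<lambda>k. hardy_norm m p (sum_diff m (n k) f)) \<longlonglongrightarrow> 0)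
     \<and>
     (\<forall>n :: nat \<Rightarrow> nat.
        strict_mono n \<and> (\<forall>k. n k > 0) \<and> (SUP k. enat (rho m (n k))) = \<infinity>
        \<longrightarrow> (\<exists>f\<in>hardy m p. \<exists>s :: nat \<Rightarrow> nat. strict_mono s \<and>
              ennreal_bigo (\<lambda>k. modulus m p (high_idx m (n (s k))) f)
                (\<lambda>k. real (gen_pow m (low_idx m (n (s k)))) powr (1 / p - 1)
                      / real (gen_pow m (high_idx m (n (s k)))) powr (1 / p - 1)) \<and>
              (\<exists>c>0. limsup (\<lambda>k. weak_norm m p (\<lambda>x. mart_sum m (n (s k)) f x - mart_lim f x))
                        > ennreal c)))"
proof -
  interpret vilenkin_group m by unfold_locales (rule assms(1))
  obtain B where B: "\<And>k. m k \<le> B" using assms(2) by (auto simp: bdd_above_def)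
  let ?c = "(real B / (1 - 2 powr (p - 1)) + 1) powr (1 / p)"
  have "(2::real) powr (p - 1) < 1" using assms(4) powr_less_mono[of "p - 1" 0 2] by simp
  then have "0 < real B / (1 - 2 powr (p - 1)) + 1" by (intro add_nonneg_pos) auto
  then have c: "0 < ?c" by simp
  have rate: "hardy_norm m p (sum_diff m n f)
      \<le> ennreal (?c * real (gen_pow m (high_idx m n)) powr (1 / p - 1)
                   / real (gen_pow m (low_idx m n)) powr (1 / p - 1))
        * modulus m p k f"
    if "f \<in> hardy m p" "gen_pow m k < n \<and> n \<le> gen_pow m (Suc k)" for f k n
    using that by (intro hardy_norm_sum_diff_le[OF B assms(3,4)]) (auto simp: hardy_def)
  show ?thesis
  proof (intro conjI)
    show "\<exists>c>0. \<forall>f\<in>hardy m p. \<forall>k n. gen_pow m k < n \<and> n \<le> gen_pow m (Suc k) \<longrightarrow>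
        hardy_norm m p (sum_diff m n f)
          \<le> ennreal (c * real (gen_pow m (high_idx m n)) powr (1 / p - 1)
                       / real (gen_pow m (low_idx m n)) powr (1 / p - 1))
            * modulus m p k f"
      by (intro exI[of _ ?c] conjI ballI allI impI c) (rule rate)
  qed (use hardy_norm_sum_diff_tendsto_0[OF B assms(3,4)]
      ex_slowly_approximated_martingale[OF B assms(3,4)] in \<open>auto simp: hardy_def\<close>)
qed

end
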